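(* Let $G$ be a compact Lie group, let $\rho: G \to \mathrm{GL}(V)$ be an irreducible finite-dimensional complex representation, and let $W_{l_1},\dots,W_{l_q}: G\to\mathbb{C}$ be a collection of single-argument Wilson loops with respect to $\rho$. Let $\lambda\in\mathbb{C}$ be the eigenvalue of the Casimir, $\rho(C)=\lambda\,\mathrm{id}_V$, and let $n_r$ be the number of factors $g^{\pm1}$ in $W_{l_r}$. Then, with $dg$ the normalized Haar measure, $$\lambda \sum_{r=1}^q n_r \int_G W_{l_1}\cdots W_{l_q}\,dg = -2\sum_{1\le r<s\le q}\int_G \mathcal{M}(W_{l_r},W_{l_s})\prod_{k\ne r,s}W_{l_k}\,dg-\sum_{r=1}^q\int_G\mathcal{T}(W_{l_r})\prod_{k\neq r}W_{l_k}\,dg,$$ where $\mathcal{M}$ denotes the total merger and $\mathcal{T}$ the total twisting.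
   Context: Setting: $G$ is a compact Lie group with Lie algebra $\mathfrak g$, $\kappa$ is a fixed $\mathrm{Ad}_G$-invariant positive-definite symmetric bilinear form on $\mathfrak g$, and $\{\xi^a\}$ is a $\kappa$-orthonormal basis of $\mathfrak g$. $C=\sum_a\xi^a\xi^a\in \mathrm{U}(\mathfrak g)$ is the Casimir invariant. The induced Lie algebra representation is also denoted $\rho$. Wilson loops: for $l=((c_1,\sigma_1),\dots,(c_n,\sigma_n))\in(G\times\{\pm1\})^n$, the single-argument Wilson loop is $W_l(g)=\mathrm{tr}\,\rho(c_1g^{\sigma_1}c_2g^{\sigma_2}\cdots c_ng^{\sigma_n})$. For positions $a,b\in\{1,\dots,n\}$ put, with indices read cyclically modulo $n$, $$P^l_{a,b}(g)=\rho\bigl(c_{a+1}\,g^{\sigma_{a+1}}\,c_{a+2}\,g^{\sigma_{a+2}}\cdots g^{\sigma_{b-1}}\,c_b\bigr),$$ going once cyclically from $a+1$ to $b$ (a full cycle if $a=b$). Thus $W_l(g)=\mathrm{tr}(P^l_{j,j}(g)\rho(g^{\sigma_j}))$ for every $j$, and $W_l(g)=\mathrm{tr}(P^l_{j',j}(g)\rho(g^{\sigma_j})P^l_{j,j'}(g)\rho(g^{\sigma_{j'}}))$ for $j\ne j'$. Put $X_a^{+1}(g)=\rho(g)\rho(\xi^a)$ and $X_a^{-1}(g)=-\rho(\xi^a)\rho(g^{-1})$. Merging: for loops $l,l'$ of lengths $n,n'$ (signs $\sigma,\sigma'$), $\mathcal M_{jj'}(W_l,W_{l'})(g)=\sum_a\mathrm{tr}\bigl(P^l_{j,j}(g)X_a^{\sigma_j}(g)\bigr)\,\mathrm{tr}\bigl(P^{l'}_{j',j'}(g)X_a^{\sigma'_{j'}}(g)\bigr)$,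 and the total merger is $\mathcal M(W_l,W_{l'})=\sum_{j=1}^{n}\sum_{j'=1}^{n'}\mathcal M_{jj'}(W_l,W_{l'})$. Twisting: for $j\ne j'$, $\mathcal T_{jj'}(W_l)(g)=\sum_a\mathrm{tr}\bigl(P^l_{j',j}(g)X_a^{\sigma_j}(g)P^l_{j,j'}(g)X_a^{\sigma_{j'}}(g)\bigr)$, and the total twisting is $\mathcal T(W_l)=\sum_{j\neq j'}\mathcal T_{jj'}(W_l)$, the sum running over ordered pairs of distinct positions. *)

theory Defs
  imports "HOL-Analysis.Analysis" "HOL-Algebra.Coset"
begin

section \<open>Smooth manifolds\<close>

text \<open>
  \<open>ck_on k S f\<close> is the usual notion of a \<open>C\<^sup>k\<close> map on an open subset \<open>S\<close> of a finite-dimensional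
  normed space: all iterated directional derivatives up to order \<open>k\<close> exist (as values of
  Frechet derivatives) and are continuous.
\<close>

primrec ck_on :: "nat \<Rightarrow> 'a::real_normed_vector set \<Rightarrow> ('a \<Rightarrow> 'b::real_normed_vector) \<Rightarrow> bool" where
  "ck_on 0 S f \<longleftrightarrow> continuous_on S f"
| "ck_on (Suc k) S f \<longleftrightarrow>
     (\<forall>x\<in>S. f differentiable (at x)) \<and> (\<forall>v. ck_on k S (\<lambda>x. frechet_derivative f (at x) v))"

definition smooth_on :: "'a::real_normed_vector set \<Rightarrow> ('a \<Rightarrow> 'b::real_normed_vector) \<Rightarrow> bool" where
  "smooth_on S f \<longleftrightarrow> (\<forall>k. ck_on k S f)"

type_synonym ('p, 'e) chart = "'p set \<times> ('p \<Rightarrow> 'e)"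

definition smooth_atlas :: "'p topology \<Rightarrow> ('p, 'e::real_normed_vector) chart set \<Rightarrow> bool" where
  "smooth_atlas T A \<longleftrightarrow>
     (\<forall>(U, \<phi>)\<in>A. openin T U \<and> open (\<phi> ` U) \<and>
        homeomorphic_map (subtopology T U) (top_of_set (\<phi> ` U)) \<phi>) \<and>
     (\<Union>(U, \<phi>)\<in>A. U) = topspace T \<and>
     (\<forall>(U, \<phi>)\<in>A. \<forall>(V, \<psi>)\<in>A. smooth_on (\<phi> ` (U \<inter> V)) (\<psi> \<circ> inv_into U \<phi>))"

definition prod_atlas ::
  "('p, 'e) chart set \<Rightarrow> ('q, 'f) chart set \<Rightarrow> ('p \<times> 'q, 'e \<times> 'f) chart set" where
  "prod_atlas A B = {(U \<times> V, map_prod \<phi> \<psi>) | U \<phi> V \<psi>. (U, \<phi>) \<in> A \<and> (V, \<psi>) \<in> B}"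

definition smooth_map ::
  "'p topology \<Rightarrow> ('p, 'e::real_normed_vector) chart set \<Rightarrow>
   'q topology \<Rightarrow> ('q, 'f::real_normed_vector) chart set \<Rightarrow> ('p \<Rightarrow> 'q) \<Rightarrow> bool" where
  "smooth_map T A T' B f \<longleftrightarrow> continuous_map T T' f \<and>
     (\<forall>(U, \<phi>)\<in>A. \<forall>(V, \<psi>)\<in>B. smooth_on (\<phi> ` {p\<in>U. f p \<in> V}) (\<psi> \<circ> f \<circ> inv_into U \<phi>))"

text \<open>Smooth functions on a manifold with values in a normed space; the values outside the
  manifold are irrelevant.\<close>

definition smooth_fun :: "('p, 'e::real_normed_vector) chart set \<Rightarrow> ('p \<Rightarrow> 'b::real_normed_vector) \<Rightarrow> bool" where
  "smooth_fun A f \<longleftrightarrow> (\<forall>(U, \<phi>)\<in>A. smooth_on (\<phi> ` U) (f \<circ> inv_into U \<phi>))"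

text \<open>
  Tangent vectors at \<open>p\<close> are derivations at \<open>p\<close> of the algebra of smooth real functions.
  Since functions are total in HOL, a derivation must not depend on the values of its argument
  outside the manifold, and it is given the value 0 on non-smooth arguments, so that two tangent
  vectors are equal iff they agree on all smooth functions.
\<close>

type_synonym 'p derivation = "('p \<Rightarrow> real) \<Rightarrow> real"

definition tangent_space ::
  "'p topology \<Rightarrow> ('p, 'e::real_normed_vector) chart set \<Rightarrow> 'p \<Rightarrow> 'p derivation set" where
  "tangent_space T A p = {v.
     (\<forall>f. \<not> smooth_fun A f \<longrightarrow> v f = 0) \<and>
     (\<forall>f h. smooth_fun A f \<and> smooth_fun A h \<and> (\<forall>x\<in>topspace T. f x = h x) \<longrightarrow> v f = v h) \<and>
     (\<forall>f h. smooth_fun A f \<and> smooth_fun A h \<longrightarrow> v (\<lambda>x. f x + h x) = v f + v h) \<and>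
     (\<forall>c f. smooth_fun A f \<longrightarrow> v (\<lambda>x. c * f x) = c * v f) \<and>
     (\<forall>f h. smooth_fun A f \<and> smooth_fun A h \<longrightarrow> v (\<lambda>x. f x * h x) = f p * v h + h p * v f)}"


section \<open>Lie groups\<close>

text \<open>
  The model space \<open>'e\<close> is an arbitrary finite-dimensional real normed space rather than a
  \<open>euclidean_space\<close>, because the latter class excludes dimension 0 and thereby finite groups.
\<close>

locale lie_group = group G for G :: "('g, 'm) monoid_scheme" (structure) +
  fixes T :: "'g topology" and A :: "('g, 'e::real_normed_vector) chart set"
  assumes finite_dim: "\<exists>B::'e set. finite B \<and> span B = UNIV"
    and topspace_eq: "topspace T = carrier G"
    and hausdorff: "Hausdorff_space T"
    and second_countable: "second_countable T"
    and atlas: "smooth_atlas T A"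
    and smooth_mult: "smooth_map (prod_topology T T) (prod_atlas A A) T A (\<lambda>(x, y). x \<otimes> y)"
    and smooth_inv: "smooth_map T A T A (\<lambda>x. inv x)"

text \<open>The Lie algebra, as the real vector space \<open>T\<^sub>eG\<close> with pointwise operations, and the adjoint
  action, i.e. the differential at the unit of conjugation by \<open>g\<close>.\<close>

definition lie_algebra ::
  "('g, 'm) monoid_scheme \<Rightarrow> 'g topology \<Rightarrow> ('g, 'e::real_normed_vector) chart set \<Rightarrow> 'g derivation set" where
  "lie_algebra G T A = tangent_space T A \<one>\<^bsub>G\<^esub>"

definition Ad :: "('g, 'm) monoid_scheme \<Rightarrow> 'g \<Rightarrow> 'g derivation \<Rightarrow> 'g derivation" where
  "Ad G g v = (\<lambda>f. v (\<lambda>x. f (g \<otimes>\<^bsub>G\<^esub> x \<otimes>\<^bsub>G\<^esub> inv\<^bsub>G\<^esub> g)))"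

definition Ad_invariant_inner_product ::
  "('g, 'm) monoid_scheme \<Rightarrow> 'g topology \<Rightarrow> ('g, 'e::real_normed_vector) chart set \<Rightarrow>
   ('g derivation \<Rightarrow> 'g derivation \<Rightarrow> real) \<Rightarrow> bool" where
  "Ad_invariant_inner_product G T A \<kappa> \<longleftrightarrow>
     (\<forall>u\<in>lie_algebra G T A. \<forall>v\<in>lie_algebra G T A.
        \<kappa> u v = \<kappa> v u \<and>
        (\<forall>w\<in>lie_algebra G T A. \<kappa> (\<lambda>f. u f + v f) w = \<kappa> u w + \<kappa> v w) \<and>
        (\<forall>c. \<kappa> (\<lambda>f. c * u f) v = c * \<kappa> u v) \<and>
        (\<forall>g\<in>carrier G. \<kappa> (Ad G g u) (Ad G g v) = \<kappa> u v)) \<and>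
     (\<forall>u\<in>lie_algebra G T A. u \<noteq> (\<lambda>f. 0) \<longrightarrow> \<kappa> u u > 0)"

definition orthonormal_basis ::
  "('g, 'm) monoid_scheme \<Rightarrow> 'g topology \<Rightarrow> ('g, 'e::real_normed_vector) chart set \<Rightarrow>
   ('g derivation \<Rightarrow> 'g derivation \<Rightarrow> real) \<Rightarrow> nat \<Rightarrow> (nat \<Rightarrow> 'g derivation) \<Rightarrow> bool" where
  "orthonormal_basis G T A \<kappa> d \<xi> \<longleftrightarrow>
     (\<forall>a<d. \<xi> a \<in> lie_algebra G T A) \<and>
     (\<forall>a<d. \<forall>b<d. \<kappa> (\<xi> a) (\<xi> b) = (if a = b then 1 else 0)) \<and>
     (\<forall>v\<in>lie_algebra G T A. \<exists>c. v = (\<lambda>f. \<Sum>a<d. c a * \<xi> a f))"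

text \<open>Normalized Haar measure. Regularity is automatic, since Lie groups are second countable
  and locally compact Hausdorff.\<close>

definition normalized_haar_measure ::
  "('g, 'm) monoid_scheme \<Rightarrow> 'g topology \<Rightarrow> 'g measure \<Rightarrow> bool" where
  "normalized_haar_measure G T \<mu> \<longleftrightarrow>
     sets \<mu> = sets (sigma (topspace T) {U. openin T U}) \<and>
     emeasure \<mu> (carrier G) = 1 \<and>
     (\<forall>g\<in>carrier G. \<forall>E\<in>sets \<mu>. emeasure \<mu> (g <#\<^bsub>G\<^esub> E) = emeasure \<mu> E)"


section \<open>Representations\<close>

definition GL :: "(complex^'n^'n) monoid" where
  "GL = \<lparr>carrier = {M. invertible M}, mult = (**), one = mat 1\<rparr>"

definition lie_group_rep ::
  "('g, 'm) monoid_scheme \<Rightarrow> ('g, 'e::real_normed_vector) chart set \<Rightarrow> ('g \<Rightarrow> complex^'n^'n) \<Rightarrow> bool" where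
  "lie_group_rep G A \<rho> \<longleftrightarrow> \<rho> \<in> hom G GL \<and> smooth_fun A \<rho>"

text \<open>\<open>vec.subspace\<close> is the notion of complex subspace of \<open>complex^'n\<close>. The representation space
  is never zero, as \<open>'n\<close> is nonempty.\<close>

definition irreducible_rep :: "('g, 'm) monoid_scheme \<Rightarrow> ('g \<Rightarrow> complex^'n^'n) \<Rightarrow> bool" where
  "irreducible_rep G \<rho> \<longleftrightarrow>
     (\<forall>S. vec.subspace S \<and> (\<forall>g\<in>carrier G. \<forall>x\<in>S. \<rho> g *v x \<in> S) \<longrightarrow> S = {0} \<or> S = UNIV)"

text \<open>The induced Lie algebra representation: the differential of \<open>\<rho>\<close> at the unit, applied to the
  derivation \<open>v\<close>, is obtained by applying \<open>v\<close> to the (real and imaginary parts of the) entries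
  of \<open>\<rho>\<close>.\<close>

definition lie_algebra_rep :: "('g \<Rightarrow> complex^'n^'n) \<Rightarrow> 'g derivation \<Rightarrow> complex^'n^'n" where
  "lie_algebra_rep \<rho> v =
     (\<chi> i j. Complex (v (\<lambda>g. Re (\<rho> g $ i $ j))) (v (\<lambda>g. Im (\<rho> g $ i $ j))))"

text \<open>The action of \<open>\<Sum>\<^sub>a \<xi>\<^sub>a \<xi>\<^sub>a\<close> in the extension of the Lie algebra representation to the
  universal enveloping algebra.\<close>

definition rep_casimir ::
  "('g \<Rightarrow> complex^'n^'n) \<Rightarrow> nat \<Rightarrow> (nat \<Rightarrow> 'g derivation) \<Rightarrow> complex^'n^'n" where
  "rep_casimir \<rho> d \<xi> = (\<Sum>a<d. lie_algebra_rep \<rho> (\<xi> a) ** lie_algebra_rep \<rho> (\<xi> a))"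


section \<open>Wilson loops\<close>

text \<open>A loop is a list of pairs \<open>(c, \<sigma>)\<close>; positions are numbered from 0.\<close>

type_synonym 'g loop = "('g \<times> int) list"

definition loops :: "('g, 'm) monoid_scheme \<Rightarrow> 'g loop set" where
  "loops G = lists (carrier G \<times> {1, -1})"

definition word :: "('g, 'm) monoid_scheme \<Rightarrow> 'g loop \<Rightarrow> 'g \<Rightarrow> 'g" where
  "word G l g = foldr (\<lambda>(c, \<sigma>) x. c \<otimes>\<^bsub>G\<^esub> g [^]\<^bsub>G\<^esub> \<sigma> \<otimes>\<^bsub>G\<^esub> x) l \<one>\<^bsub>G\<^esub>"

definition wilson :: "('g, 'm) monoid_scheme \<Rightarrow> ('g \<Rightarrow> complex^'n^'n) \<Rightarrow> 'g loop \<Rightarrow> 'g \<Rightarrow> complex" where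
  "wilson G \<rho> l g = trace (\<rho> (word G l g))"

text \<open>\<open>segment l a b\<close> lists the factors at the positions strictly between \<open>a\<close> and \<open>b\<close>, going once
  cyclically from \<open>a + 1\<close> to \<open>b - 1\<close>; these are all \<open>length l - 1\<close> other positions if \<open>a = b\<close>.\<close>

definition segment :: "'g loop \<Rightarrow> nat \<Rightarrow> nat \<Rightarrow> 'g loop" where
  "segment l a b = take ((b + length l - Suc a) mod length l) (rotate (Suc a) l)"

definition wilson_path ::
  "('g, 'm) monoid_scheme \<Rightarrow> ('g \<Rightarrow> complex^'n^'n) \<Rightarrow> 'g loop \<Rightarrow> nat \<Rightarrow> nat \<Rightarrow> 'g \<Rightarrow> complex^'n^'n" where
  "wilson_path G \<rho> l a b g = \<rho> (word G (segment l a b) g \<otimes>\<^bsub>G\<^esub> fst (l ! b))"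

definition insertion ::
  "('g, 'm) monoid_scheme \<Rightarrow> ('g \<Rightarrow> complex^'n^'n) \<Rightarrow> 'g derivation \<Rightarrow> int \<Rightarrow> 'g \<Rightarrow> complex^'n^'n" where
  "insertion G \<rho> v \<sigma> g =
     (if \<sigma> = 1 then \<rho> g ** lie_algebra_rep \<rho> v
      else - (lie_algebra_rep \<rho> v ** \<rho> (inv\<^bsub>G\<^esub> g)))"

definition merger_at ::
  "('g, 'm) monoid_scheme \<Rightarrow> ('g \<Rightarrow> complex^'n^'n) \<Rightarrow> nat \<Rightarrow> (nat \<Rightarrow> 'g derivation) \<Rightarrow>
   nat \<Rightarrow> nat \<Rightarrow> 'g loop \<Rightarrow> 'g loop \<Rightarrow> 'g \<Rightarrow> complex" where
  "merger_at G \<rho> d \<xi> j j' l l' g =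
     (\<Sum>a<d. trace (wilson_path G \<rho> l j j g ** insertion G \<rho> (\<xi> a) (snd (l ! j)) g) *
            trace (wilson_path G \<rho> l' j' j' g ** insertion G \<rho> (\<xi> a) (snd (l' ! j')) g))"

definition merger ::
  "('g, 'm) monoid_scheme \<Rightarrow> ('g \<Rightarrow> complex^'n^'n) \<Rightarrow> nat \<Rightarrow> (nat \<Rightarrow> 'g derivation) \<Rightarrow>
   'g loop \<Rightarrow> 'g loop \<Rightarrow> 'g \<Rightarrow> complex" where
  "merger G \<rho> d \<xi> l l' g =
     (\<Sum>j<length l. \<Sum>j'<length l'. merger_at G \<rho> d \<xi> j j' l l' g)"

definition twisting_at ::
  "('g, 'm) monoid_scheme \<Rightarrow> ('g \<Rightarrow> complex^'n^'n) \<Rightarrow> nat \<Rightarrow> (nat \<Rightarrow> 'g derivation) \<Rightarrow>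
   nat \<Rightarrow> nat \<Rightarrow> 'g loop \<Rightarrow> 'g \<Rightarrow> complex" where
  "twisting_at G \<rho> d \<xi> j j' l g =
     (\<Sum>a<d. trace (wilson_path G \<rho> l j' j g ** insertion G \<rho> (\<xi> a) (snd (l ! j)) g **
                   wilson_path G \<rho> l j j' g ** insertion G \<rho> (\<xi> a) (snd (l ! j')) g))"

definition twisting ::
  "('g, 'm) monoid_scheme \<Rightarrow> ('g \<Rightarrow> complex^'n^'n) \<Rightarrow> nat \<Rightarrow> (nat \<Rightarrow> 'g derivation) \<Rightarrow>
   'g loop \<Rightarrow> 'g \<Rightarrow> complex" where
  "twisting G \<rho> d \<xi> l g =
     (\<Sum>(j, j')\<in>{(j, j'). j < length l \<and> j' < length l \<and> j \<noteq> j'}. twisting_at G \<rho> d \<xi> j j' l g)"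

end

theory Submission
  imports Defs
begin

text \<open>
  Let \<open>\<Delta> = \<Sum>\<^sub>a D\<^sub>a D\<^sub>a\<close> with \<open>(D\<^sub>v f)(g) = v (x \<mapsto> f (g x))\<close>, the left-invariant derivative
  along \<open>v \<in> \<gg>\<close>. Since \<open>D\<^sub>v\<close> replaces a factor \<open>g\<^sup>\<sigma>\<close> by its insertion \<open>X\<^sub>v\<^sup>\<sigma>\<close>, applying
  \<open>\<Delta>\<close> to \<open>\<Prod> W\<close> hits one factor twice (a Casimir eigenvalue \<open>\<lambda>\<close>), two factors of the
  same loop (a twisting) or two factors of different loops (a merger). The formula says that the
  Haar integral of \<open>\<Delta> (\<Prod> W)\<close> vanishes.

  All functions involved lie in the algebra generated by the matrix entries of \<open>\<rho>(g)\<close> and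
  \<open>\<rho>(g\<^sup>-\<^sup>1)\<close>, in which \<open>f (x y)\<close> is a finite sum \<open>\<Sum>\<^sub>i a\<^sub>i(x) b\<^sub>i(y)\<close>. This makes the
  integration purely algebraic: right invariance of the left Haar measure on such \<open>f\<close> follows by
  computing the double integral of \<open>f (x\<^sup>-\<^sup>1 y)\<close> in both orders, and then \<open>\<integral> D\<^sub>v f = 0\<close>
  because \<open>v\<close> kills the constant \<open>y \<mapsto> \<integral> f (x y) dx\<close>. In particular no flows or exponential
  map are needed.
\<close>

section \<open>Calculus of continuously differentiable functions\<close>

text \<open>The derivative at a point of \<open>S\<close> sees a whole neighbourhood. As
  \<open>S\<close> is open, agreement on \<open>S\<close> already forces equal Frechet derivatives
  there, and the induction continues with these.\<close>

lemma ck_on_cong: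
  assumes "open S" "ck_on k S f" "\<And>x. x \<in> S \<Longrightarrow> f x = g x"
  shows "ck_on k S g"
  using assms(2,3)
proof (induction k arbitrary: f g)
  case 0
  then show ?case by (metis continuous_on_cong ck_on.simps(1))
next
  case (Suc k)
  have D: "(g has_derivative frechet_derivative f (at x)) (at x)" if "x \<in> S" for x
    using Suc.prems that \<open>open S\<close>
    by (auto simp: frechet_derivative_works intro: has_derivative_transform_within_open)
  have "frechet_derivative f (at x) = frechet_derivative g (at x)" if "x \<in> S" for x
    using frechet_derivative_at[OF D[OF that]] .
  then have "ck_on k S (\<lambda>x. frechet_derivative g (at x) v)" for v
    using Suc.IH[of "\<lambda>x. frechet_derivative f (at x) v"] Suc.prems by simp
  with D show ?case by (auto simp: differentiable_def)
qed

text \<open>Allows an explicit derivative formula in place of \<open>frechet_derivative\<close>; the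
  closure properties below are proved through it.\<close>

lemma ck_on_Suc_intro:
  assumes "\<And>x. x \<in> S \<Longrightarrow> (f has_derivative f' x) (at x)" "open S" "\<And>v. ck_on k S (\<lambda>x. f' x v)"
  shows "ck_on (Suc k) S f"
proof -
  have "frechet_derivative f (at x) = f' x" if "x \<in> S" for x
    using frechet_derivative_at[OF assms(1)[OF that]] by simp
  then have "ck_on k S (\<lambda>x. frechet_derivative f (at x) v)" for v
    using ck_on_cong[OF assms(2,3)] by simp
  then show ?thesis
    using assms(1) by (auto simp: differentiable_def)
qed

lemma ck_on_Suc_has_derivative:
  "ck_on (Suc k) S f \<Longrightarrow> x \<in> S \<Longrightarrow> (f has_derivative frechet_derivative f (at x)) (at x)"
  by (simp add: frechet_derivative_works)

lemma ck_on_SucD: "ck_on (Suc k) S f \<Longrightarrow> ck_on k S f"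
proof (induction k arbitrary: f)
  case 0
  then show ?case
    by (auto intro!: differentiable_imp_continuous_on differentiable_at_imp_differentiable_on)
next
  case (Suc k)
  then show ?case using ck_on.simps(2) by blast
qed

lemma ck_on_const: "open S \<Longrightarrow> ck_on k S (\<lambda>x. c)"
proof (induction k arbitrary: c)
  case (Suc k)
  show ?case
    by (rule ck_on_Suc_intro[where f' = "\<lambda>x v. 0"]) (use Suc in auto)
qed simp

lemma ck_on_bounded_linear:
  assumes "bounded_linear h" "open S" "ck_on k S f"
  shows "ck_on k S (\<lambda>x. h (f x))"
  using assms(3)
proof (induction k arbitrary: f)
  case 0
  then show ?case
    using assms(1) by (simp add: bounded_linear.continuous_on)
next
  case (Suc k)
  show ?case
    by (rule ck_on_Suc_intro[OF bounded_linear.has_derivative[OF assms(1)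
            ck_on_Suc_has_derivative[OF Suc.prems]]])
      (use Suc assms in auto)
qed

lemma ck_on_add:
  assumes "open S" "ck_on k S f" "ck_on k S g"
  shows "ck_on k S (\<lambda>x. f x + g x)"
  using assms(2,3)
proof (induction k arbitrary: f g)
  case 0
  then show ?case by (simp add: continuous_on_add)
next
  case (Suc k)
  show ?case
    by (rule ck_on_Suc_intro[OF has_derivative_add[OF
            ck_on_Suc_has_derivative[OF Suc.prems(1)] ck_on_Suc_has_derivative[OF Suc.prems(2)]]])
      (use Suc assms(1) in auto)
qed

text \<open>The induction generalises over both factors, because the Leibniz rule produces new
  products. In each of these the undifferentiated factor is lowered by one order with
  \<open>ck_on_SucD\<close>.\<close>

lemma ck_on_mult:
  fixes f g :: "'a::real_normed_vector \<Rightarrow> 'b::real_normed_algebra"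
  assumes "open S" "ck_on k S f" "ck_on k S g"
  shows "ck_on k S (\<lambda>x. f x * g x)"
  using assms(2,3)
proof (induction k arbitrary: f g)
  case 0
  then show ?case by (simp add: continuous_on_mult)
next
  case (Suc k)
  show ?case
  proof (rule ck_on_Suc_intro[OF has_derivative_mult[OF
            ck_on_Suc_has_derivative[OF Suc.prems(1)] ck_on_Suc_has_derivative[OF Suc.prems(2)]]])
    show "ck_on k S (\<lambda>x. f x * frechet_derivative g (at x) v + frechet_derivative f (at x) v * g x)"
      for v
      by (intro ck_on_add assms(1) Suc.IH) (use Suc.prems in \<open>auto intro: ck_on_SucD\<close>)
  qed (use assms(1) in auto)
qed

text \<open>The derivative of \<open>inverse (f x)\<close> is a product of
  \<open>inverse (f x)\<close> with the derivative of \<open>f\<close>, so the induction hypothesis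
  for the same \<open>f\<close> suffices.\<close>

lemma ck_on_inverse:
  fixes f :: "'a::real_normed_vector \<Rightarrow> 'b::real_normed_field"
  assumes "open S" "ck_on k S f" "\<And>x. x \<in> S \<Longrightarrow> f x \<noteq> 0"
  shows "ck_on k S (\<lambda>x. inverse (f x))"
  using assms(2)
proof (induction k)
  case 0
  then show ?case using assms(3) by (simp add: continuous_on_inverse)
next
  case (Suc k)
  show ?case
  proof (rule ck_on_Suc_intro[where
          f' = "\<lambda>x v. (-1) * (inverse (f x) * frechet_derivative f (at x) v * inverse (f x))"])
    show "ck_on k S (\<lambda>x. (-1) * (inverse (f x) * frechet_derivative f (at x) v * inverse (f x)))"
      for v
      by (intro ck_on_mult ck_on_const assms(1) Suc.IH) (use Suc.prems in \<open>auto intro: ck_on_SucD\<close>)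
    show "((\<lambda>x. inverse (f x)) has_derivative
        (\<lambda>v. (-1) * (inverse (f x) * frechet_derivative f (at x) v * inverse (f x)))) (at x)"
      if "x \<in> S" for x
      using Deriv.has_derivative_inverse[OF assms(3)[OF that] ck_on_Suc_has_derivative[OF Suc.prems that]]
      by simp
  qed (fact assms(1))
qed

section \<open>Smooth functions on a Lie group\<close>

context lie_group
begin

lemma chart_open: "(U, \<phi>) \<in> A \<Longrightarrow> open (\<phi> ` U)"
  using atlas by (auto simp: smooth_atlas_def)

lemma chart_subset: "(U, \<phi>) \<in> A \<Longrightarrow> U \<subseteq> carrier G"
  using atlas topspace_eq by (auto simp: smooth_atlas_def)

text \<open>Smoothness is tested on chart images, and \<open>inv_into U \<phi>\<close> sends these
  back into the carrier, so junk values elsewhere are never seen.\<close>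

lemma smooth_fun_cong:
  assumes "smooth_fun A f" "\<And>x. x \<in> carrier G \<Longrightarrow> f x = h x"
  shows "smooth_fun A h"
proof -
  have "ck_on k (\<phi> ` U) (h \<circ> inv_into U \<phi>)" if "(U, \<phi>) \<in> A" for U \<phi> k
  proof (rule ck_on_cong[OF chart_open[OF that]])
    show "ck_on k (\<phi> ` U) (f \<circ> inv_into U \<phi>)"
      using assms(1) that by (auto simp: smooth_fun_def smooth_on_def)
    show "(f \<circ> inv_into U \<phi>) z = (h \<circ> inv_into U \<phi>) z" if "z \<in> \<phi> ` U" for z
      using assms(2) inv_into_into[OF that] chart_subset[OF \<open>(U, \<phi>) \<in> A\<close>] by auto
  qed
  then show ?thesis by (auto simp: smooth_fun_def smooth_on_def)
qed

lemma smooth_funI: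
  "(\<And>U \<phi> k. (U, \<phi>) \<in> A \<Longrightarrow> ck_on k (\<phi> ` U) (\<lambda>z. f (inv_into U \<phi> z))) \<Longrightarrow> smooth_fun A f"
  by (auto simp: smooth_fun_def smooth_on_def comp_def)

lemma smooth_funD:
  "smooth_fun A f \<Longrightarrow> (U, \<phi>) \<in> A \<Longrightarrow> ck_on k (\<phi> ` U) (\<lambda>z. f (inv_into U \<phi> z))"
  by (auto simp: smooth_fun_def smooth_on_def comp_def dest!: bspec)

lemma smooth_fun_const: "smooth_fun A (\<lambda>_. c)"
  by (intro smooth_funI ck_on_const chart_open)

lemma smooth_fun_bounded_linear:
  assumes "bounded_linear h" "smooth_fun A f"
  shows "smooth_fun A (\<lambda>x. h (f x))"
  by (rule smooth_funI, rule ck_on_bounded_linear[OF assms(1) chart_open smooth_funD[OF assms(2)]])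

lemma smooth_fun_add:
  assumes "smooth_fun A f" "smooth_fun A h"
  shows "smooth_fun A (\<lambda>x. f x + h x)"
  by (rule smooth_funI, rule ck_on_add[OF chart_open smooth_funD[OF assms(1)] smooth_funD[OF assms(2)]])

lemma smooth_fun_mult:
  fixes f h :: "'g \<Rightarrow> 'b::real_normed_algebra"
  assumes "smooth_fun A f" "smooth_fun A h"
  shows "smooth_fun A (\<lambda>x. f x * h x)"
  by (rule smooth_funI, rule ck_on_mult[OF chart_open smooth_funD[OF assms(1)] smooth_funD[OF assms(2)]])

lemma smooth_fun_inverse:
  fixes f :: "'g \<Rightarrow> 'b::real_normed_field"
  assumes "smooth_fun A f" "\<And>x. x \<in> carrier G \<Longrightarrow> f x \<noteq> 0"
  shows "smooth_fun A (\<lambda>x. inverse (f x))"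
proof (rule smooth_funI, rule ck_on_inverse[OF chart_open smooth_funD[OF assms(1)]])
  show "f (inv_into U \<phi> z) \<noteq> 0" if "(U, \<phi>) \<in> A" "z \<in> \<phi> ` U" for U \<phi> z
    using assms(2) inv_into_into[OF that(2)] chart_subset[OF that(1)] by auto
qed

lemma smooth_fun_sum:
  "(\<And>i. i \<in> I \<Longrightarrow> smooth_fun A (f i)) \<Longrightarrow> smooth_fun A (\<lambda>x. \<Sum>i\<in>I. f i x)"
  by (induction I rule: infinite_finite_induct) (auto intro: smooth_fun_add smooth_fun_const)

lemma smooth_fun_prod:
  fixes f :: "'i \<Rightarrow> 'g \<Rightarrow> 'b::real_normed_field"
  shows "(\<And>i. i \<in> I \<Longrightarrow> smooth_fun A (f i)) \<Longrightarrow> smooth_fun A (\<lambda>x. \<Prod>i\<in>I. f i x)"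
  by (induction I rule: infinite_finite_induct) (auto intro: smooth_fun_mult smooth_fun_const)

text \<open>The Leibniz formula makes the determinant a polynomial in the entries. This prepares for
  Cramer's rule in \<open>smooth_rho_inv\<close>.\<close>

lemma smooth_fun_det:
  fixes M :: "'g \<Rightarrow> 'b::real_normed_field^'n^'n"
  assumes "\<And>i j. smooth_fun A (\<lambda>x. M x $ i $ j)"
  shows "smooth_fun A (\<lambda>x. det (M x))"
  unfolding det_def using assms
  by (intro smooth_fun_sum smooth_fun_mult smooth_fun_const smooth_fun_prod)

text \<open>Order 0 of smoothness is continuity in each chart. Composing with the chart map gives
  continuity on each chart domain, and the open domains cover the group.\<close>

lemma smooth_fun_continuous_map:
  assumes "smooth_fun A f"
  shows "continuous_map T euclidean f"
proof -
  have loc: "continuous_map (subtopology T U) euclidean f" if U: "(U, \<phi>) \<in> A" for U \<phi>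
  proof -
    have hom: "homeomorphic_map (subtopology T U) (top_of_set (\<phi> ` U)) \<phi>"
      using atlas U by (auto simp: smooth_atlas_def)
    have "U \<subseteq> topspace T" using chart_subset[OF U] topspace_eq by simp
    have "inj_on \<phi> U"
      using homeomorphic_imp_injective_map[OF hom] \<open>U \<subseteq> topspace T\<close> by (simp add: Int_absorb1)
    have "continuous_on (\<phi> ` U) (f \<circ> inv_into U \<phi>)"
      using smooth_funD[OF assms U, of 0] by (simp add: comp_def)
    then have "continuous_map (top_of_set (\<phi> ` U)) euclidean (f \<circ> inv_into U \<phi>)"
      by simp
    then have "continuous_map (subtopology T U) euclidean (f \<circ> inv_into U \<phi> \<circ> \<phi>)"
      using continuous_map_compose homeomorphic_imp_continuous_map[OF hom] by blast
    then show ?thesis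
      by (rule continuous_map_eq) (use \<open>inj_on \<phi> U\<close> in auto)
  qed
  have "openin T {x \<in> topspace T. f x \<in> V}" if "open V" for V
  proof (subst openin_subopen, intro ballI)
    fix x assume x: "x \<in> {x \<in> topspace T. f x \<in> V}"
    then have "x \<in> (\<Union>(U, \<phi>)\<in>A. U)"
      using atlas by (simp add: smooth_atlas_def)
    then obtain U \<phi> where U: "(U, \<phi>) \<in> A" "x \<in> U" by auto
    have "openin T U" using U atlas by (auto simp: smooth_atlas_def)
    moreover have "openin (subtopology T U) {y \<in> topspace (subtopology T U). f y \<in> V}"
      using loc[OF U(1)] that by (auto simp: continuous_map_def)
    ultimately have "openin T {y \<in> topspace (subtopology T U). f y \<in> V}"
      by (rule openin_trans_full[rotated])
    then show "\<exists>W. openin T W \<and> x \<in> W \<and> W \<subseteq> {x \<in> topspace T. f x \<in> V}"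
      using x U(2) by (intro exI[of _ "{y \<in> topspace (subtopology T U). f y \<in> V}"]) auto
  qed
  then show ?thesis by (auto simp: continuous_map_def)
qed

section \<open>Tangent vectors on complex-valued functions\<close>

text \<open>Derivations act on real functions only; this is their extension to complex functions,
  matching the entries of \<open>lie_algebra_rep\<close>.\<close>

definition cderiv :: "'g derivation \<Rightarrow> ('g \<Rightarrow> complex) \<Rightarrow> complex" where
  "cderiv v f = Complex (v (\<lambda>x. Re (f x))) (v (\<lambda>x. Im (f x)))"

lemmas smooth_fun_Re = smooth_fun_bounded_linear[OF bounded_linear_Re]
lemmas smooth_fun_Im = smooth_fun_bounded_linear[OF bounded_linear_Im]

context
  fixes v assumes v: "v \<in> lie_algebra G T A"
begin

lemma tangent_add: "smooth_fun A f \<Longrightarrow> smooth_fun A h \<Longrightarrow> v (\<lambda>x. f x + h x) = v f + v h"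
  using v unfolding lie_algebra_def tangent_space_def by blast

lemma tangent_scale: "smooth_fun A f \<Longrightarrow> v (\<lambda>x. c * f x) = c * v f"
  using v unfolding lie_algebra_def tangent_space_def by blast

lemma tangent_mult:
  "smooth_fun A f \<Longrightarrow> smooth_fun A h \<Longrightarrow> v (\<lambda>x. f x * h x) = f \<one> * v h + h \<one> * v f"
  using v unfolding lie_algebra_def tangent_space_def by blast

text \<open>The locality clause of \<open>tangent_space\<close> asks for both functions to be
  smooth; smoothness of \<open>h\<close> is inherited from \<open>f\<close>.\<close>

lemma tangent_cong:
  assumes "smooth_fun A f" "\<And>x. x \<in> carrier G \<Longrightarrow> f x = h x"
  shows "v f = v h"
proof -
  have "\<forall>x\<in>topspace T. f x = h x" using assms(2) topspace_eq by simp
  then show ?thesis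
    using v assms(1) smooth_fun_cong[OF assms] unfolding lie_algebra_def tangent_space_def by blast
qed

text \<open>The Leibniz rule applied to \<open>1 = 1 * 1\<close> doubles the value on the constant
  1, which must therefore vanish.\<close>

lemma tangent_const: "v (\<lambda>_. c) = 0"
proof -
  have "v (\<lambda>_. 1) = 0"
    using tangent_mult[OF smooth_fun_const smooth_fun_const, of 1 1] by simp
  then show ?thesis
    using tangent_scale[OF smooth_fun_const, of c 1] by simp
qed

lemma cderiv_const: "cderiv v (\<lambda>_. c) = 0"
  by (simp add: cderiv_def tangent_const complex_eq_iff)

lemma cderiv_add:
  assumes "smooth_fun A f" "smooth_fun A h"
  shows "cderiv v (\<lambda>x. f x + h x) = cderiv v f + cderiv v h"
  using tangent_add[OF smooth_fun_Re[OF assms(1)] smooth_fun_Re[OF assms(2)]]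
    tangent_add[OF smooth_fun_Im[OF assms(1)] smooth_fun_Im[OF assms(2)]]
  by (simp add: cderiv_def complex_eq_iff)

lemma cderiv_cong:
  assumes "smooth_fun A f" "\<And>x. x \<in> carrier G \<Longrightarrow> f x = h x"
  shows "cderiv v f = cderiv v h"
proof -
  have "v (\<lambda>x. Re (f x)) = v (\<lambda>x. Re (h x))"
    by (rule tangent_cong[OF smooth_fun_Re[OF assms(1)]]) (simp add: assms(2))
  moreover have "v (\<lambda>x. Im (f x)) = v (\<lambda>x. Im (h x))"
    by (rule tangent_cong[OF smooth_fun_Im[OF assms(1)]]) (simp add: assms(2))
  ultimately show ?thesis by (simp add: cderiv_def)
qed

lemma cderiv_mult:
  assumes "smooth_fun A f" "smooth_fun A h"
  shows "cderiv v (\<lambda>x. f x * h x) = f \<one> * cderiv v h + cderiv v f * h \<one>"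
proof -
  note s = smooth_fun_Re[OF assms(1)] smooth_fun_Im[OF assms(1)]
    smooth_fun_Re[OF assms(2)] smooth_fun_Im[OF assms(2)]
  \<comment> \<open>The difference is written with a factor -1 so that additivity and homogeneity of
    \<open>v\<close> apply.\<close>
  have "v (\<lambda>x. Re (f x * h x)) = v (\<lambda>x. Re (f x) * Re (h x) + (-1) * (Im (f x) * Im (h x)))"
    by simp
  also have "\<dots> = v (\<lambda>x. Re (f x) * Re (h x)) + v (\<lambda>x. (-1) * (Im (f x) * Im (h x)))"
    by (intro tangent_add smooth_fun_mult smooth_fun_const s)
  also have "v (\<lambda>x. (-1) * (Im (f x) * Im (h x))) = (-1) * v (\<lambda>x. Im (f x) * Im (h x))"
    by (intro tangent_scale smooth_fun_mult s)
  finally have re: "v (\<lambda>x. Re (f x * h x)) =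
      v (\<lambda>x. Re (f x) * Re (h x)) - v (\<lambda>x. Im (f x) * Im (h x))" by simp
  have "v (\<lambda>x. Im (f x * h x)) = v (\<lambda>x. Re (f x) * Im (h x) + Im (f x) * Re (h x))"
    by simp
  also have "\<dots> = v (\<lambda>x. Re (f x) * Im (h x)) + v (\<lambda>x. Im (f x) * Re (h x))"
    by (intro tangent_add smooth_fun_mult s)
  finally have im: "v (\<lambda>x. Im (f x * h x)) =
      v (\<lambda>x. Re (f x) * Im (h x)) + v (\<lambda>x. Im (f x) * Re (h x))" .
  show ?thesis
    unfolding cderiv_def re im tangent_mult[OF s(1) s(3)] tangent_mult[OF s(2) s(4)]
      tangent_mult[OF s(1) s(4)] tangent_mult[OF s(2) s(3)]
    by (simp add: complex_eq_iff algebra_simps)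
qed

lemma cderiv_scale: "smooth_fun A f \<Longrightarrow> cderiv v (\<lambda>x. c * f x) = c * cderiv v f"
  using cderiv_mult[OF smooth_fun_const] by (simp add: cderiv_const)

lemma cderiv_sum:
  "(\<And>i. i \<in> I \<Longrightarrow> smooth_fun A (f i)) \<Longrightarrow> cderiv v (\<lambda>x. \<Sum>i\<in>I. f i x) = (\<Sum>i\<in>I. cderiv v (f i))"
  by (induction I rule: infinite_finite_induct) (auto simp: cderiv_add cderiv_const smooth_fun_sum)

end

end

section \<open>Representative functions\<close>

locale compact_lie_group_rep = lie_group G T A
  for G :: "('g, 'm) monoid_scheme" (structure)
    and T :: "'g topology"
    and A :: "('g, 'e::real_normed_vector) chart set" +
  fixes \<rho> :: "'g \<Rightarrow> complex^'n^'n" and \<mu> :: "'g measure"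
  assumes compact: "compact_space T"
    and haar: "normalized_haar_measure G T \<mu>"
    and rep: "lie_group_rep G A \<rho>"
begin

section \<open>Elementary identities and smoothness of the representation\<close>

lemma rho_mult: "x \<in> carrier G \<Longrightarrow> y \<in> carrier G \<Longrightarrow> \<rho> (x \<otimes> y) = \<rho> x ** \<rho> y"
  using rep by (auto simp: lie_group_rep_def hom_def GL_def)

lemma rho_invertible: "x \<in> carrier G \<Longrightarrow> invertible (\<rho> x)"
  using rep by (auto simp: lie_group_rep_def hom_def GL_def)

text \<open>The matrix \<open>\<rho> \<one>\<close> is both idempotent and invertible.\<close>

lemma rho_one: "\<rho> \<one> = mat 1"
proof -
  obtain B where "\<rho> \<one> ** B = mat 1"
    using rho_invertible[OF one_closed] by (auto simp: invertible_def)
  moreover have "\<rho> \<one> ** \<rho> \<one> = \<rho> \<one>"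
    using rho_mult[OF one_closed one_closed] by simp
  ultimately show ?thesis by (metis matrix_mul_assoc matrix_mul_rid)
qed

lemma rho_inv_right: "x \<in> carrier G \<Longrightarrow> \<rho> x ** \<rho> (inv x) = mat 1"
  using rho_mult[of x "inv x"] by (simp add: rho_one)

lemma rho_inv_left: "x \<in> carrier G \<Longrightarrow> \<rho> (inv x) ** \<rho> x = mat 1"
  using rho_mult[of "inv x" x] by (simp add: rho_one)

lemma smooth_rho: "smooth_fun A (\<lambda>x. \<rho> x $ i $ j)"
proof -
  have "smooth_fun A \<rho>" using rep by (simp add: lie_group_rep_def)
  from smooth_fun_bounded_linear[OF bounded_linear_vec_nth this]
  show ?thesis by (rule smooth_fun_bounded_linear[OF bounded_linear_vec_nth])
qed

text \<open>Cramer's rule writes each entry of the inverse matrix as a quotient of two determinants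
  that are smooth in \<open>x\<close>, with a denominator that does not vanish on the group.\<close>

lemma smooth_rho_inv: "smooth_fun A (\<lambda>x. \<rho> (inv x) $ i $ j)"
proof -
  \<comment> \<open>\<open>N x\<close> is \<open>\<rho> x\<close> with column \<open>i\<close>
    replaced by the unit vector \<open>axis j 1\<close>; its determinant is the Cramer numerator for
    entry \<open>(i, j)\<close> of the inverse.\<close>
  define N where "N x = (\<chi> a b. if b = i then axis j 1 $ a else \<rho> x $ a $ b)" for x
  have entry: "smooth_fun A (\<lambda>x. N x $ a $ b)" for a b
    by (cases "b = i") (simp_all add: N_def smooth_fun_const smooth_rho)
  have det0: "det (\<rho> x) \<noteq> 0" if "x \<in> carrier G" for x
    using rho_invertible[OF that] by (simp add: invertible_det_nz)
  have "smooth_fun A (\<lambda>x. det (N x) * inverse (det (\<rho> x)))"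
    by (intro smooth_fun_mult smooth_fun_inverse smooth_fun_det entry smooth_rho det0)
  then show ?thesis
  proof (rule smooth_fun_cong)
    fix x assume x: "x \<in> carrier G"
    have "\<rho> x *v (\<rho> (inv x) *v axis j 1) = axis j 1"
      by (simp add: matrix_vector_mul_assoc rho_inv_right x)
    then have "\<rho> (inv x) *v axis j 1 =
        (\<chi> k. det (\<chi> a b. if b = k then axis j 1 $ a else \<rho> x $ a $ b) / det (\<rho> x))"
      using cramer[OF det0[OF x]] by blast
    then have "(\<rho> (inv x) *v axis j 1) $ i = det (N x) / det (\<rho> x)"
      by (simp add: N_def)
    then show "det (N x) * inverse (det (\<rho> x)) = \<rho> (inv x) $ i $ j"
      by (simp add: matrix_vector_mult_def axis_def if_distrib[of "(*) _"] divide_inverse cong: if_cong)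
  qed
qed

text \<open>Values outside the carrier are junk, hence the closure under \<open>eq_on\<close>.\<close>

inductive rep_fun :: "('g \<Rightarrow> complex) \<Rightarrow> bool" where
  const: "rep_fun (\<lambda>_. c)"
| entry: "rep_fun (\<lambda>x. \<rho> x $ i $ j)"
| entry_inv: "rep_fun (\<lambda>x. \<rho> (inv x) $ i $ j)"
| add: "rep_fun f \<Longrightarrow> rep_fun h \<Longrightarrow> rep_fun (\<lambda>x. f x + h x)"
| mult: "rep_fun f \<Longrightarrow> rep_fun h \<Longrightarrow> rep_fun (\<lambda>x. f x * h x)"
| eq_on: "rep_fun f \<Longrightarrow> (\<And>x. x \<in> carrier G \<Longrightarrow> f x = h x) \<Longrightarrow> rep_fun h"

lemma rep_fun_smooth: "rep_fun f \<Longrightarrow> smooth_fun A f"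
proof (induction rule: rep_fun.induct)
  case const
  show ?case by (rule smooth_fun_const)
next
  case entry
  show ?case by (rule smooth_rho)
next
  case entry_inv
  show ?case by (rule smooth_rho_inv)
next
  case add
  show ?case by (rule smooth_fun_add[OF add.IH])
next
  case mult
  show ?case by (rule smooth_fun_mult[OF mult.IH])
next
  case (eq_on f h)
  show ?case by (rule smooth_fun_cong[OF eq_on.IH eq_on.hyps(2)])
qed

text \<open>Inversion exchanges the two kinds of generators. Since \<open>inv (inv x) = x\<close>
  holds only on the carrier, one case goes through \<open>eq_on\<close>.\<close>

lemma rep_fun_inv: "rep_fun f \<Longrightarrow> rep_fun (\<lambda>x. f (inv x))"
proof (induction rule: rep_fun.induct)
  case const
  show ?case by (rule rep_fun.const)
next
  case entry
  show ?case by (rule rep_fun.entry_inv)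
next
  case (entry_inv i j)
  show ?case by (rule rep_fun.eq_on[OF rep_fun.entry[of i j]]) simp
next
  case add
  show ?case by (rule rep_fun.add[OF add.IH])
next
  case mult
  show ?case by (rule rep_fun.mult[OF mult.IH])
next
  case (eq_on f h)
  show ?case by (rule rep_fun.eq_on[OF eq_on.IH]) (simp add: eq_on.hyps)
qed

lemma rep_fun_sum:
  assumes "\<And>i. i \<in> I \<Longrightarrow> rep_fun (f i)"
  shows "rep_fun (\<lambda>x. \<Sum>i\<in>I. f i x)"
  using assms
proof (induction I rule: infinite_finite_induct)
  case (insert i I)
  then have "rep_fun (\<lambda>x. f i x + (\<Sum>i\<in>I. f i x))"
    by (intro rep_fun.add) auto
  then show ?case using insert.hyps by simp
qed (simp_all add: rep_fun.const)

lemma rep_fun_prod: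
  assumes "\<And>i. i \<in> I \<Longrightarrow> rep_fun (f i)"
  shows "rep_fun (\<lambda>x. \<Prod>i\<in>I. f i x)"
  using assms
proof (induction I rule: infinite_finite_induct)
  case (insert i I)
  then have "rep_fun (\<lambda>x. f i x * (\<Prod>i\<in>I. f i x))"
    by (intro rep_fun.mult) auto
  then show ?case using insert.hyps by simp
qed (simp_all add: rep_fun.const)

text \<open>Matrix multiplication gives the expansion for the generators, and sums and products of
  expandable functions are expandable. This separation of variables is what later replaces Fubini's
  theorem and differentiation under the integral.\<close>

lemma rep_fun_expand:
  assumes "rep_fun f"
  obtains n :: nat and a b where "\<And>i. i < n \<Longrightarrow> rep_fun (a i)" "\<And>i. i < n \<Longrightarrow> rep_fun (b i)"
    "\<And>x y. x \<in> carrier G \<Longrightarrow> y \<in> carrier G \<Longrightarrow> f (x \<otimes> y) = (\<Sum>i<n. a i x * b i y)"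
proof -
  \<comment> \<open>Lists of pairs are convenient here: a sum of functions corresponds to appending,
    a product to \<open>List.product\<close>. Indices appear only at the end.\<close>
  define expands :: "('g \<Rightarrow> complex) \<Rightarrow> (('g \<Rightarrow> complex) \<times> ('g \<Rightarrow> complex)) list \<Rightarrow> bool"
    where "expands f L \<longleftrightarrow> (\<forall>(a, b)\<in>set L. rep_fun a \<and> rep_fun b) \<and>
      (\<forall>x\<in>carrier G. \<forall>y\<in>carrier G. f (x \<otimes> y) = (\<Sum>(a, b)\<leftarrow>L. a x * b y))" for f L
  \<comment> \<open>An enumeration of the index type turns the sum in a matrix product into a sum
    over a list.\<close>
  obtain xs where xs: "set xs = (UNIV :: 'n set)" "distinct xs"
    using finite_distinct_list[of "UNIV :: 'n set"] by auto
  have *: "(\<Sum>k\<leftarrow>xs. F k) = (\<Sum>k\<in>UNIV. F k)" for F :: "'n \<Rightarrow> complex"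
    using sum_list_distinct_conv_sum_set[OF xs(2)] xs(1) by metis
  have "\<exists>L. expands f L"
    using assms
  proof (induction rule: rep_fun.induct)
    case (const c)
    show ?case
      by (rule exI[of _ "[(\<lambda>_. c, \<lambda>_. 1)]"]) (simp add: expands_def rep_fun.const)
  next
    case (entry i j)
    show ?case
      by (rule exI[of _ "map (\<lambda>k. (\<lambda>x. \<rho> x $ i $ k, \<lambda>x. \<rho> x $ k $ j)) xs"])
        (auto simp: expands_def rep_fun.entry comp_def * rho_mult matrix_matrix_mult_def)
  next
    case (entry_inv i j)
    \<comment> \<open>Inversion reverses the product, \<open>\<rho> (inv (x \<otimes> y)) = \<rho>
      (inv y) ** \<rho> (inv x)\<close>, so the factor depending on \<open>x\<close> is the right
      one and carries the index \<open>j\<close>.\<close>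
    show ?case
      by (rule exI[of _ "map (\<lambda>k. (\<lambda>x. \<rho> (inv x) $ k $ j, \<lambda>x. \<rho> (inv x) $ i $ k)) xs"])
        (auto simp: expands_def rep_fun.entry_inv comp_def * rho_mult inv_mult_group
          matrix_matrix_mult_def mult.commute intro!: sum.cong)
  next
    case (add f h)
    then obtain L K where "expands f L" "expands h K" by blast
    then show ?case
      by (intro exI[of _ "L @ K"]) (auto simp: expands_def)
  next
    case (mult f h)
    then obtain L K where LK: "expands f L" "expands h K" by blast
    have prod: "(\<Sum>(a, b)\<leftarrow>L. a x * b y) * (\<Sum>(a, b)\<leftarrow>K. a x * b y) =
        (\<Sum>((a, b), (a', b'))\<leftarrow>List.product L K. (a x * a' x) * (b y * b' y))" for x y
    proof (induction L)
      case (Cons p L)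
      have "c * (\<Sum>(a, b)\<leftarrow>K. a x * b y) = (\<Sum>(a, b)\<leftarrow>K. c * (a x * b y))" for c
        by (induction K) (auto simp: algebra_simps)
      then show ?case using Cons
        by (auto simp: algebra_simps comp_def case_prod_unfold)
    qed simp
    show ?case
      by (rule exI[of _ "map (\<lambda>((a, b), (a', b')). (\<lambda>x. a x * a' x, \<lambda>x. b x * b' x))
            (List.product L K)"])
        (use LK in \<open>auto simp: expands_def prod[unfolded case_prod_unfold] comp_def case_prod_unfold
          intro!: rep_fun.mult\<close>)
  next
    case (eq_on f h)
    then obtain L where "expands f L" by blast
    then show ?case using eq_on.hyps by (intro exI[of _ L]) (auto simp: expands_def)
  qed
  then obtain L where L: "expands f L" by blast
  show ?thesis
  proof (rule that[of "length L" "\<lambda>i. fst (L ! i)" "\<lambda>i. snd (L ! i)"])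
    show "rep_fun (fst (L ! i))" "rep_fun (snd (L ! i))" if "i < length L" for i
      using L nth_mem[OF that] by (auto simp: expands_def case_prod_unfold)
    show "f (x \<otimes> y) = (\<Sum>i<length L. fst (L ! i) x * snd (L ! i) y)"
      if "x \<in> carrier G" "y \<in> carrier G" for x y
      using L that by (simp add: expands_def sum_list_sum_nth atLeast0LessThan case_prod_unfold)
  qed
qed

section \<open>Haar integrals of representative functions\<close>

lemma sets_mu: "sets \<mu> = sets (sigma (topspace T) {U. openin T U})"
  using haar by (simp add: normalized_haar_measure_def)

lemma space_mu: "space \<mu> = carrier G"
  using sets_eq_imp_space_eq[OF sets_mu] by (simp add: space_measure_of_conv topspace_eq)

lemma openin_sets: "openin T U \<Longrightarrow> U \<in> sets \<mu>"
  unfolding sets_mu by (subst sets_measure_of) (auto dest: openin_subset)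

lemma emeasure_carrier: "emeasure \<mu> (carrier G) = 1"
  using haar by (simp add: normalized_haar_measure_def)

lemma measure_carrier: "measure \<mu> (carrier G) = 1"
  by (simp add: measure_def emeasure_carrier)

lemma finite_measure_mu: "finite_measure \<mu>"
  by (rule finite_measureI) (simp add: space_mu emeasure_carrier)

lemma continuous_map_borel_measurable:
  fixes f :: "'g \<Rightarrow> 'b::topological_space"
  assumes "continuous_map T euclidean f"
  shows "f \<in> borel_measurable \<mu>"
proof (rule borel_measurableI)
  fix S :: "'b set" assume "open S"
  then have "openin T {x \<in> topspace T. f x \<in> S}"
    using assms by (auto simp: continuous_map_def)
  moreover have "f -` S \<inter> space \<mu> = {x \<in> topspace T. f x \<in> S}"
    by (auto simp: space_mu topspace_eq)
  ultimately show "f -` S \<inter> space \<mu> \<in> sets \<mu>" using openin_sets by simp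
qed

text \<open>A continuous function on a compact space is bounded and measurable, and the measure is
  finite.\<close>

lemma rep_fun_integrable:
  assumes "rep_fun f"
  shows "integrable \<mu> f"
proof -
  have f: "continuous_map T euclidean f"
    by (intro smooth_fun_continuous_map rep_fun_smooth assms)
  have "compactin T (topspace T)"
    using compact by (simp add: compact_space_def)
  then have "compact (f ` topspace T)"
    using image_compactin[OF _ f] by simp
  then obtain B where B: "\<And>x. x \<in> carrier G \<Longrightarrow> norm (f x) \<le> B"
    by (metis bounded_iff compact_imp_bounded imageI topspace_eq)
  show ?thesis
    by (rule finite_measure.integrable_const_bound[OF finite_measure_mu, where B = B])
      (use B continuous_map_borel_measurable[OF f] in \<open>auto simp: space_mu intro!: AE_I2\<close>)
qed

section \<open>Invariance of the integral under translations and inversion\<close>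

lemma translation_measurable:
  assumes h: "h \<in> carrier G"
  shows "(\<lambda>x. h \<otimes> x) \<in> measurable \<mu> \<mu>"
proof -
  have "continuous_map (prod_topology T T) T (\<lambda>(x, y). x \<otimes> y)"
    using smooth_mult by (simp add: smooth_map_def)
  moreover have "continuous_map T (prod_topology T T) (\<lambda>x. (h, x))"
    using h by (auto simp: continuous_map_pairedI topspace_eq)
  ultimately have "continuous_map T T ((\<lambda>(x, y). x \<otimes> y) \<circ> (\<lambda>x. (h, x)))"
    using continuous_map_compose by blast
  then have cont: "continuous_map T T (\<lambda>x. h \<otimes> x)"
    by (simp add: comp_def)
  have "(\<lambda>x. h \<otimes> x) \<in> measurable \<mu> (sigma (topspace T) {U. openin T U})"
  proof (rule measurable_measure_of)
    fix U assume "U \<in> {U. openin T U}"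
    then have "openin T {x \<in> topspace T. h \<otimes> x \<in> U}"
      using cont by (auto simp: continuous_map_def)
    moreover have "(\<lambda>x. h \<otimes> x) -` U \<inter> space \<mu> = {x \<in> topspace T. h \<otimes> x \<in> U}"
      by (auto simp: space_mu topspace_eq)
    ultimately show "(\<lambda>x. h \<otimes> x) -` U \<inter> space \<mu> \<in> sets \<mu>" using openin_sets by simp
  qed (use h openin_subset[of T] in \<open>auto simp: space_mu topspace_eq\<close>)
  then show ?thesis
    by (simp add: measurable_cong_sets[OF refl sets_mu])
qed

text \<open>The preimage of \<open>E\<close> under translation by \<open>h\<close> is the coset
  \<open>inv h <# E\<close>, which has the same measure; hence the pushforward of
  \<open>\<mu>\<close> is \<open>\<mu>\<close>.\<close>

lemma integral_left_invariant:
  fixes f :: "'g \<Rightarrow> complex"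
  assumes "f \<in> borel_measurable \<mu>" and h: "h \<in> carrier G"
  shows "(\<integral>x. f (h \<otimes> x) \<partial>\<mu>) = (\<integral>x. f x \<partial>\<mu>)"
proof -
  have "distr \<mu> \<mu> (\<lambda>x. h \<otimes> x) = \<mu>"
  proof (rule measure_eqI)
    fix E assume "E \<in> sets (distr \<mu> \<mu> (\<lambda>x. h \<otimes> x))"
    then have E: "E \<in> sets \<mu>" "E \<subseteq> carrier G"
      using sets.sets_into_space[of E \<mu>] by (auto simp: space_mu)
    have "(\<lambda>x. h \<otimes> x) -` E \<inter> space \<mu> = inv h <# E"
    proof -
      have "x \<in> inv h <# E" if "x \<in> carrier G" "h \<otimes> x \<in> E" for x
        using that h by (auto simp: l_coset_def m_assoc[symmetric] intro!: bexI[of _ "h \<otimes> x"])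
      moreover have "x \<in> carrier G \<and> h \<otimes> x \<in> E" if "x \<in> inv h <# E" for x
        using that h E(2) by (auto simp: l_coset_def m_assoc[symmetric] subset_iff)
      ultimately show ?thesis by (auto simp: space_mu)
    qed
    then have "emeasure (distr \<mu> \<mu> (\<lambda>x. h \<otimes> x)) E = emeasure \<mu> (l_coset G (inv h) E)"
      using emeasure_distr[OF translation_measurable[OF h] E(1)] by simp
    also have "\<dots> = emeasure \<mu> E"
      using haar h E(1) by (simp add: normalized_haar_measure_def)
    finally show "emeasure (distr \<mu> \<mu> (\<lambda>x. h \<otimes> x)) E = emeasure \<mu> E" .
  qed simp
  then show ?thesis
    using integral_distr[OF translation_measurable[OF h] assms(1)] by simp
qed

text \<open>Both sides equal the double integral of \<open>f (inv x \<otimes> y)\<close>, evaluated in the two possible orders;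
  the expansion of \<open>f\<close> reduces Fubini's theorem to linearity.\<close>

lemma integral_rep_fun_inv:
  assumes "rep_fun f"
  shows "(\<integral>x. f (inv x) \<partial>\<mu>) = (\<integral>x. f x \<partial>\<mu>)"
proof -
  define I where "I h = (\<integral>x. h x \<partial>\<mu>)" for h :: "'g \<Rightarrow> complex"
  have I_const: "I (\<lambda>_. c) = c" for c
    by (simp add: I_def space_mu measure_carrier)
  have I_cong: "I h = I k" if "\<And>x. x \<in> carrier G \<Longrightarrow> h x = k x" for h k
    unfolding I_def by (rule Bochner_Integration.integral_cong) (use that in \<open>auto simp: space_mu\<close>)
  have I_left: "I (\<lambda>x. h (y \<otimes> x)) = I h" if "rep_fun h" "y \<in> carrier G" for h y
    unfolding I_def
    using integral_left_invariant that rep_fun_integrable[of h] by (simp add: integrable_iff_bounded)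
  from assms obtain n :: nat and a b
    where a: "\<And>i. i < n \<Longrightarrow> rep_fun (a i)" and b: "\<And>i. i < n \<Longrightarrow> rep_fun (b i)"
      and ab: "\<And>x y. x \<in> carrier G \<Longrightarrow> y \<in> carrier G \<Longrightarrow> f (x \<otimes> y) = (\<Sum>i<n. a i x * b i y)"
    by (rule rep_fun_expand) blast
  have int: "integrable \<mu> (\<lambda>x. a i (inv x))" "integrable \<mu> (b i)" if "i < n" for i
    by (intro rep_fun_integrable rep_fun_inv a b that)+
  \<comment> \<open>Here \<open>x\<close> is a parameter and the integration runs over
    \<open>y\<close>, using left translation by \<open>inv x\<close>.\<close>
  have 1: "I f = (\<Sum>i<n. a i (inv x) * I (b i))" if x: "x \<in> carrier G" for x
  proof -
    have "I f = I (\<lambda>y. f (inv x \<otimes> y))" using I_left[OF assms] x by simp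
    also have "\<dots> = I (\<lambda>y. \<Sum>i<n. a i (inv x) * b i y)"
      by (rule I_cong) (use x ab in simp)
    also have "\<dots> = (\<Sum>i<n. a i (inv x) * I (b i))"
      unfolding I_def using int by (simp add: Bochner_Integration.integral_sum)
    finally show ?thesis .
  qed
  \<comment> \<open>Now \<open>y\<close> is the parameter: left translation by \<open>inv y\<close>
    turns \<open>f (inv x)\<close> into \<open>f (inv x \<otimes> y)\<close>.\<close>
  have 2: "I (\<lambda>x. f (inv x)) = (\<Sum>i<n. I (\<lambda>x. a i (inv x)) * b i y)" if y: "y \<in> carrier G" for y
  proof -
    have "I (\<lambda>x. f (inv x)) = I (\<lambda>x. f (inv (inv y \<otimes> x)))"
      using I_left[OF rep_fun_inv[OF assms], of "inv y"] y by simp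
    also have "\<dots> = I (\<lambda>x. \<Sum>i<n. a i (inv x) * b i y)"
      by (rule I_cong) (use y ab in \<open>simp add: inv_mult_group\<close>)
    also have "\<dots> = (\<Sum>i<n. I (\<lambda>x. a i (inv x)) * b i y)"
      unfolding I_def using int by (simp add: Bochner_Integration.integral_sum)
    finally show ?thesis .
  qed
  \<comment> \<open>The total mass is 1, so each constant equals its own integral. Integrating
    \<open>2\<close> over \<open>y\<close> and \<open>1\<close> over \<open>x\<close> yields the
    same sum of products.\<close>
  have "I (\<lambda>x. f (inv x)) = I (\<lambda>y. \<Sum>i<n. I (\<lambda>x. a i (inv x)) * b i y)"
    using I_cong[OF 2] I_const by simp
  also have "\<dots> = (\<Sum>i<n. I (\<lambda>x. a i (inv x)) * I (b i))"
    unfolding I_def using int by (simp add: Bochner_Integration.integral_sum)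
  also have "\<dots> = I (\<lambda>x. \<Sum>i<n. a i (inv x) * I (b i))"
    unfolding I_def using int by (simp add: Bochner_Integration.integral_sum)
  also have "\<dots> = I f"
    using I_cong[OF 1] I_const by simp
  finally show ?thesis by (simp add: I_def)
qed

text \<open>Freezing one argument in the expansion leaves a linear combination of representative
  functions.\<close>

lemma rep_fun_translate:
  assumes "rep_fun f" "h \<in> carrier G"
  shows "rep_fun (\<lambda>x. f (x \<otimes> h))" "rep_fun (\<lambda>x. f (h \<otimes> x))"
proof -
  from assms(1) obtain n :: nat and a b
    where a: "\<And>i. i < n \<Longrightarrow> rep_fun (a i)" and b: "\<And>i. i < n \<Longrightarrow> rep_fun (b i)"
      and ab: "\<And>x y. x \<in> carrier G \<Longrightarrow> y \<in> carrier G \<Longrightarrow> f (x \<otimes> y) = (\<Sum>i<n. a i x * b i y)"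
    by (rule rep_fun_expand) blast
  have "rep_fun (\<lambda>x. \<Sum>i<n. a i x * b i h)"
    by (intro rep_fun_sum rep_fun.mult rep_fun.const a) simp
  then show "rep_fun (\<lambda>x. f (x \<otimes> h))"
    by (rule rep_fun.eq_on) (use ab assms(2) in simp)
  have "rep_fun (\<lambda>x. \<Sum>i<n. a i h * b i x)"
    by (intro rep_fun_sum rep_fun.mult rep_fun.const b) simp
  then show "rep_fun (\<lambda>x. f (h \<otimes> x))"
    by (rule rep_fun.eq_on) (use ab assms(2) in simp)
qed

text \<open>Inversion preserves the integral and converts right translation by \<open>h\<close> into
  left translation by \<open>inv h\<close>.\<close>

lemma integral_right_invariant:
  assumes f: "rep_fun f" and h: "h \<in> carrier G"
  shows "(\<integral>x. f (x \<otimes> h) \<partial>\<mu>) = (\<integral>x. f x \<partial>\<mu>)"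
proof -
  have "(\<integral>x. f (x \<otimes> h) \<partial>\<mu>) = (\<integral>x. f (inv x \<otimes> h) \<partial>\<mu>)"
    using integral_rep_fun_inv[OF rep_fun_translate(1)[OF f h]] by simp
  also have "\<dots> = (\<integral>x. f (inv (inv h \<otimes> x)) \<partial>\<mu>)"
    by (rule Bochner_Integration.integral_cong) (use h in \<open>auto simp: space_mu inv_mult_group\<close>)
  also have "\<dots> = (\<integral>x. f (inv x) \<partial>\<mu>)"
    by (rule integral_left_invariant[of "\<lambda>x. f (inv x)"])
      (use h in \<open>auto intro: borel_measurable_integrable rep_fun_integrable rep_fun_inv f\<close>)
  also have "\<dots> = (\<integral>x. f x \<partial>\<mu>)"
    by (rule integral_rep_fun_inv[OF f])
  finally show ?thesis .
qed

section \<open>Left-invariant derivatives of representative functions\<close>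

definition lderiv :: "'g derivation \<Rightarrow> ('g \<Rightarrow> complex) \<Rightarrow> 'g \<Rightarrow> complex" where
  "lderiv v f g = cderiv v (\<lambda>x. f (g \<otimes> x))"

definition rep_mat :: "('g \<Rightarrow> complex^'k^'k) \<Rightarrow> bool" where
  "rep_mat M \<longleftrightarrow> (\<forall>i j. rep_fun (\<lambda>x. M x $ i $ j))"

definition mderiv :: "'g derivation \<Rightarrow> ('g \<Rightarrow> complex^'k^'k) \<Rightarrow> 'g \<Rightarrow> complex^'k^'k" where
  "mderiv v M g = (\<chi> i j. lderiv v (\<lambda>x. M x $ i $ j) g)"

lemma rep_mat_const: "rep_mat (\<lambda>_. M)"
  unfolding rep_mat_def by (blast intro: rep_fun.const)

lemma rep_mat_mult: "rep_mat M \<Longrightarrow> rep_mat N \<Longrightarrow> rep_mat (\<lambda>x. M x ** N x)"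
  unfolding rep_mat_def matrix_matrix_mult_def by (simp, intro allI rep_fun_sum rep_fun.mult) blast+

lemma rep_mat_eq_on:
  "rep_mat M \<Longrightarrow> (\<And>x. x \<in> carrier G \<Longrightarrow> M x = N x) \<Longrightarrow> rep_mat N"
  unfolding rep_mat_def by (intro allI, rule rep_fun.eq_on[of "\<lambda>x. M x $ _ $ _"]) auto

lemma rep_mat_trace: "rep_mat M \<Longrightarrow> rep_fun (\<lambda>x. trace (M x))"
  unfolding rep_mat_def trace_def by (intro rep_fun_sum) blast

lemma rep_mat_rho: "rep_mat \<rho>"
  by (simp add: rep_mat_def rep_fun.entry)

lemma rep_mat_rho_inv: "rep_mat (\<lambda>x. \<rho> (inv x))"
  by (simp add: rep_mat_def rep_fun.entry_inv)

lemma rep_mat_uminus: "rep_mat M \<Longrightarrow> rep_mat (\<lambda>x. - M x)"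
  unfolding rep_mat_def
  using rep_fun.mult[OF rep_fun.const[of "-1"], of "\<lambda>x. M x $ _ $ _"] by simp

context
  fixes v assumes v: "v \<in> lie_algebra G T A"
begin

lemma smooth_fun_translate: "rep_fun f \<Longrightarrow> g \<in> carrier G \<Longrightarrow> smooth_fun A (\<lambda>x. f (g \<otimes> x))"
  by (rule rep_fun_smooth[OF rep_fun_translate(2)])

lemma lderiv_cong:
  assumes "rep_fun f" "\<And>x. x \<in> carrier G \<Longrightarrow> f x = h x" "g \<in> carrier G"
  shows "lderiv v f g = lderiv v h g"
  unfolding lderiv_def
  by (rule cderiv_cong[OF v smooth_fun_translate[OF assms(1,3)]]) (use assms(2,3) in simp)

lemma lderiv_const: "lderiv v (\<lambda>_. c) g = 0"
  unfolding lderiv_def by (rule cderiv_const[OF v])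

lemma lderiv_mult:
  assumes "rep_fun f" "rep_fun h" "g \<in> carrier G"
  shows "lderiv v (\<lambda>x. f x * h x) g = f g * lderiv v h g + lderiv v f g * h g"
  using cderiv_mult[OF v smooth_fun_translate[OF assms(1,3)] smooth_fun_translate[OF assms(2,3)]]
    assms(3) by (simp add: lderiv_def)

lemma lderiv_sum:
  assumes "\<And>i. i \<in> I \<Longrightarrow> rep_fun (f i)" "g \<in> carrier G"
  shows "lderiv v (\<lambda>x. \<Sum>i\<in>I. f i x) g = (\<Sum>i\<in>I. lderiv v (f i) g)"
  unfolding lderiv_def
  by (rule cderiv_sum[OF v smooth_fun_translate[OF assms]])

text \<open>The differentiated factor is removed from the index set rather than divided out, as its
  value may be zero.\<close>

lemma lderiv_prod:
  assumes "finite I" "\<And>i. i \<in> I \<Longrightarrow> rep_fun (f i)" "g \<in> carrier G"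
  shows "lderiv v (\<lambda>x. \<Prod>i\<in>I. f i x) g = (\<Sum>r\<in>I. lderiv v (f r) g * (\<Prod>k\<in>I - {r}. f k g))"
  using assms(1,2)
proof (induction I rule: finite_induct)
  case empty
  then show ?case by (simp add: lderiv_const)
next
  case (insert i I)
  have "lderiv v (\<lambda>x. \<Prod>j\<in>insert i I. f j x) g = lderiv v (\<lambda>x. f i x * (\<Prod>j\<in>I. f j x)) g"
    using insert.hyps by simp
  also have "\<dots> = f i g * lderiv v (\<lambda>x. \<Prod>j\<in>I. f j x) g + lderiv v (f i) g * (\<Prod>j\<in>I. f j g)"
    by (rule lderiv_mult) (use insert assms(3) in \<open>auto intro: rep_fun_prod\<close>)
  also have "f i g * lderiv v (\<lambda>x. \<Prod>j\<in>I. f j x) g =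
      (\<Sum>r\<in>I. lderiv v (f r) g * (f i g * (\<Prod>k\<in>I - {r}. f k g)))"
    using insert by (simp add: sum_distrib_left mult.left_commute)
  also have "\<dots> = (\<Sum>r\<in>I. lderiv v (f r) g * (\<Prod>k\<in>insert i I - {r}. f k g))"
    by (rule sum.cong)
      (use insert.hyps in \<open>auto simp: insert_Diff_if intro!: arg_cong[where f = "(*) _"]\<close>)
  finally show ?case
    using insert.hyps by (simp add: add.commute)
qed

text \<open>For fixed \<open>x\<close> the derivation acts on the variable \<open>y\<close> alone,
  so it falls on the \<open>b i\<close> and leaves constant coefficients. The expansion is returned
  as well because \<open>integral_lderiv\<close> needs the same \<open>a\<close> and
  \<open>b\<close> in both formulas.\<close>

lemma lderiv_expand:
  assumes "rep_fun f"
  obtains n :: nat and a b where "\<And>i. i < n \<Longrightarrow> rep_fun (a i)" "\<And>i. i < n \<Longrightarrow> rep_fun (b i)"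
    "\<And>x y. x \<in> carrier G \<Longrightarrow> y \<in> carrier G \<Longrightarrow> f (x \<otimes> y) = (\<Sum>i<n. a i x * b i y)"
    "\<And>x. x \<in> carrier G \<Longrightarrow> lderiv v f x = (\<Sum>i<n. a i x * cderiv v (b i))"
proof -
  from assms obtain n :: nat and a b
    where a: "\<And>i. i < n \<Longrightarrow> rep_fun (a i)" and b: "\<And>i. i < n \<Longrightarrow> rep_fun (b i)"
      and ab: "\<And>x y. x \<in> carrier G \<Longrightarrow> y \<in> carrier G \<Longrightarrow> f (x \<otimes> y) = (\<Sum>i<n. a i x * b i y)"
    by (rule rep_fun_expand) blast
  have "lderiv v f x = (\<Sum>i<n. a i x * cderiv v (b i))" if x: "x \<in> carrier G" for x
  proof -
    have smooth: "smooth_fun A (\<lambda>y. a i x * b i y)" if "i < n" for i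
      by (intro rep_fun_smooth rep_fun.mult rep_fun.const b that)
    have "cderiv v (\<lambda>y. \<Sum>i<n. a i x * b i y) = lderiv v f x"
      unfolding lderiv_def
      by (rule cderiv_cong[OF v]) (use ab x smooth in \<open>auto intro: smooth_fun_sum\<close>)
    moreover have "cderiv v (\<lambda>y. \<Sum>i<n. a i x * b i y) = (\<Sum>i<n. a i x * cderiv v (b i))"
      using cderiv_sum[OF v, of "{..<n}" "\<lambda>i y. a i x * b i y"] smooth
        cderiv_scale[OF v rep_fun_smooth[OF b]] by simp
    ultimately show ?thesis by simp
  qed
  with a b ab show ?thesis by (rule that)
qed

text \<open>Closure under differentiation makes second derivatives integrable and lets
  \<open>integral_lderiv\<close> apply to a first derivative.\<close>

lemma rep_fun_lderiv:
  assumes "rep_fun f"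
  shows "rep_fun (lderiv v f)"
proof -
  from assms obtain n :: nat and a b
    where a: "\<And>i. i < n \<Longrightarrow> rep_fun (a i)"
      and D: "\<And>x. x \<in> carrier G \<Longrightarrow> lderiv v f x = (\<Sum>i<n. a i x * cderiv v (b i))"
    by (rule lderiv_expand) blast
  have "rep_fun (\<lambda>x. \<Sum>i<n. a i x * cderiv v (b i))"
    by (intro rep_fun_sum rep_fun.mult rep_fun.const a) simp
  then show ?thesis by (rule rep_fun.eq_on) (simp add: D)
qed

lemma integral_lderiv:
  assumes "rep_fun f"
  shows "(\<integral>x. lderiv v f x \<partial>\<mu>) = 0"
proof -
  from assms obtain n :: nat and a b
    where a: "\<And>i. i < n \<Longrightarrow> rep_fun (a i)" and b: "\<And>i. i < n \<Longrightarrow> rep_fun (b i)"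
      and ab: "\<And>x y. x \<in> carrier G \<Longrightarrow> y \<in> carrier G \<Longrightarrow> f (x \<otimes> y) = (\<Sum>i<n. a i x * b i y)"
      and D: "\<And>x. x \<in> carrier G \<Longrightarrow> lderiv v f x = (\<Sum>i<n. a i x * cderiv v (b i))"
    by (rule lderiv_expand) blast
  have int: "integrable \<mu> (a i)" if "i < n" for i
    by (intro rep_fun_integrable a that)
  \<comment> \<open>As a function of \<open>y\<close> this sum is the integral of
    \<open>f (x \<otimes> y)\<close> over \<open>x\<close>; right invariance makes it
    constant.\<close>
  have const: "(\<Sum>i<n. (\<integral>x. a i x \<partial>\<mu>) * b i y) = (\<integral>x. f x \<partial>\<mu>)" if y: "y \<in> carrier G" for y
  proof -
    have "(\<integral>x. f x \<partial>\<mu>) = (\<integral>x. f (x \<otimes> y) \<partial>\<mu>)"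
      using integral_right_invariant[OF assms y] by simp
    also have "\<dots> = (\<integral>x. (\<Sum>i<n. a i x * b i y) \<partial>\<mu>)"
      by (rule Bochner_Integration.integral_cong) (use y ab in \<open>auto simp: space_mu\<close>)
    also have "\<dots> = (\<Sum>i<n. (\<integral>x. a i x \<partial>\<mu>) * b i y)"
      using int by (simp add: Bochner_Integration.integral_sum)
    finally show ?thesis by simp
  qed
  have smooth: "smooth_fun A (\<lambda>y. c * b i y)" if "i < n" for i c
    by (intro rep_fun_smooth rep_fun.mult rep_fun.const b that)
  have "(\<integral>x. lderiv v f x \<partial>\<mu>) = (\<integral>x. (\<Sum>i<n. a i x * cderiv v (b i)) \<partial>\<mu>)"
    by (rule Bochner_Integration.integral_cong) (use D in \<open>auto simp: space_mu\<close>)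
  also have "\<dots> = (\<Sum>i<n. (\<integral>x. a i x \<partial>\<mu>) * cderiv v (b i))"
    using int by (simp add: Bochner_Integration.integral_sum)
  \<comment> \<open>Linearity lets \<open>v\<close> act on the sum as a whole, which is the constant
    found above.\<close>
  also have "\<dots> = cderiv v (\<lambda>y. \<Sum>i<n. (\<integral>x. a i x \<partial>\<mu>) * b i y)"
    using cderiv_sum[OF v, of "{..<n}" "\<lambda>i y. (\<integral>x. a i x \<partial>\<mu>) * b i y"] smooth
      cderiv_scale[OF v rep_fun_smooth[OF b]] by simp
  also have "\<dots> = cderiv v (\<lambda>y. \<integral>x. f x \<partial>\<mu>)"
    by (rule cderiv_cong[OF v]) (use const smooth in \<open>auto intro: smooth_fun_sum\<close>)
  also have "\<dots> = 0" by (rule cderiv_const[OF v])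
  finally show ?thesis .
qed

section \<open>Matrix-valued derivatives\<close>

lemma lderiv_trace:
  "rep_mat M \<Longrightarrow> g \<in> carrier G \<Longrightarrow> lderiv v (\<lambda>x. trace (M x)) g = trace (mderiv v M g)"
  unfolding trace_def rep_mat_def by (subst lderiv_sum) (auto simp: mderiv_def)

lemma mderiv_const: "mderiv v (\<lambda>_. M) g = 0"
  by (simp add: mderiv_def lderiv_const vec_eq_iff)

lemma mderiv_mult:
  assumes "rep_mat M" "rep_mat N" "g \<in> carrier G"
  shows "mderiv v (\<lambda>x. M x ** N x) g = M g ** mderiv v N g + mderiv v M g ** N g"
proof -
  have "lderiv v (\<lambda>x. \<Sum>k\<in>UNIV. M x $ i $ k * N x $ k $ j) g =
      (\<Sum>k\<in>UNIV. M g $ i $ k * lderiv v (\<lambda>x. N x $ k $ j) g + lderiv v (\<lambda>x. M x $ i $ k) g * N g $ k $ j)"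
    for i j
    using assms by (subst lderiv_sum) (auto simp: rep_mat_def lderiv_mult intro: rep_fun.mult)
  then show ?thesis
    by (simp add: mderiv_def matrix_matrix_mult_def vec_eq_iff sum.distrib)
qed

lemma mderiv_cong:
  assumes "rep_mat M" "\<And>x. x \<in> carrier G \<Longrightarrow> M x = N x" "g \<in> carrier G"
  shows "mderiv v M g = mderiv v N g"
proof -
  have "lderiv v (\<lambda>x. M x $ i $ j) g = lderiv v (\<lambda>x. N x $ i $ j) g" for i j
    by (rule lderiv_cong) (use assms in \<open>auto simp: rep_mat_def\<close>)
  then show ?thesis by (simp add: mderiv_def vec_eq_iff)
qed

lemma mderiv_uminus:
  assumes "rep_mat M" "g \<in> carrier G"
  shows "mderiv v (\<lambda>x. - M x) g = - mderiv v M g"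
proof -
  have "lderiv v (\<lambda>x. - (M x $ i $ j)) g = - lderiv v (\<lambda>x. M x $ i $ j) g" for i j
    using lderiv_mult[OF rep_fun.const, of "\<lambda>x. M x $ i $ j" g "-1"] assms
    by (simp add: rep_mat_def lderiv_const)
  then show ?thesis by (simp add: mderiv_def vec_eq_iff)
qed

text \<open>In \<open>\<rho> (g \<otimes> x) = \<rho> g ** \<rho> x\<close> the left factor is
  constant in \<open>x\<close>, so only the differential of \<open>\<rho>\<close> at the unit
  remains.\<close>

lemma mderiv_rho:
  assumes g: "g \<in> carrier G"
  shows "mderiv v \<rho> g = \<rho> g ** lie_algebra_rep \<rho> v"
proof -
  have "cderiv v (\<lambda>x. \<rho> (g \<otimes> x) $ i $ j) = (\<Sum>k\<in>UNIV. \<rho> g $ i $ k * cderiv v (\<lambda>x. \<rho> x $ k $ j))" for i j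
  proof -
    have smooth: "smooth_fun A (\<lambda>x. \<rho> g $ i $ k * \<rho> x $ k $ j)" for k
      by (intro smooth_fun_mult smooth_fun_const smooth_rho)
    have "cderiv v (\<lambda>x. \<Sum>k\<in>UNIV. \<rho> g $ i $ k * \<rho> x $ k $ j) = cderiv v (\<lambda>x. \<rho> (g \<otimes> x) $ i $ j)"
      by (rule cderiv_cong[OF v smooth_fun_sum[OF smooth]])
        (simp add: rho_mult g matrix_matrix_mult_def)
    then show ?thesis
      using cderiv_sum[OF v, of UNIV "\<lambda>k x. \<rho> g $ i $ k * \<rho> x $ k $ j"] smooth
        cderiv_scale[OF v smooth_rho] by simp
  qed
  then show ?thesis
    by (simp add: mderiv_def lderiv_def vec_eq_iff matrix_matrix_mult_def lie_algebra_rep_def)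
      (simp add: cderiv_def)
qed

text \<open>Differentiate \<open>\<rho> x ** \<rho> (inv x) = mat 1\<close> and cancel
  \<open>\<rho> g\<close> on the left. This is the source of the sign and the reversed order in
  \<open>insertion\<close>.\<close>

lemma mderiv_rho_inv:
  assumes g: "g \<in> carrier G"
  shows "mderiv v (\<lambda>x. \<rho> (inv x)) g = - (lie_algebra_rep \<rho> v ** \<rho> (inv g))"
proof -
  let ?R = "lie_algebra_rep \<rho> v" and ?D = "mderiv v (\<lambda>x. \<rho> (inv x)) g"
  have "mderiv v (\<lambda>x. \<rho> x ** \<rho> (inv x)) g = mderiv v (\<lambda>x. mat 1 :: complex^'n^'n) g"
    by (rule mderiv_cong) (use g in \<open>simp_all add: rep_mat_mult rep_mat_rho rep_mat_rho_inv rho_inv_right\<close>)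
  then have "\<rho> g ** ?D + \<rho> g ** ?R ** \<rho> (inv g) = 0"
    by (simp add: mderiv_const mderiv_mult rep_mat_rho rep_mat_rho_inv mderiv_rho g)
  then have "\<rho> (inv g) ** (\<rho> g ** (?D + ?R ** \<rho> (inv g))) = 0"
    by (simp add: matrix_add_ldistrib matrix_mul_assoc)
  then have "?D + ?R ** \<rho> (inv g) = 0"
    by (simp only: matrix_mul_assoc rho_inv_left[OF g] matrix_mul_lid)
  then show ?thesis by (simp add: eq_neg_iff_add_eq_0)
qed

end

end

section \<open>Matrix identities\<close>

lemma matrix_mult_sum_right:
  fixes M :: "'a::comm_semiring_1^'n^'m"
  shows "M ** (\<Sum>i\<in>I. N i) = (\<Sum>i\<in>I. M ** N i)"
  by (induction I rule: infinite_finite_induct) (simp_all add: matrix_add_ldistrib)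

lemma matrix_add_rdistrib:
  fixes A B :: "'a::semiring_1^'n^'m"
  shows "(A + B) ** C = A ** C + B ** C"
  by (simp add: matrix_matrix_mult_def vec_eq_iff sum.distrib distrib_right)

lemma matrix_mult_minus_right:
  fixes A :: "'a::ring_1^'n^'m"
  shows "A ** (- B) = - (A ** B)"
  by (simp add: matrix_matrix_mult_def vec_eq_iff sum_negf)

lemma matrix_mult_sum_left:
  fixes M :: "'a::comm_semiring_1^'k^'n"
  shows "(\<Sum>i\<in>I. N i) ** M = (\<Sum>i\<in>I. N i ** M)"
  by (induction I rule: infinite_finite_induct) (simp_all add: matrix_add_rdistrib)

lemma trace_sum:
  fixes M :: "'i \<Rightarrow> 'a::semiring_1^'n^'n"
  shows "trace (\<Sum>i\<in>I. M i) = (\<Sum>i\<in>I. trace (M i))"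
  unfolding trace_def sum_component by (rule sum.swap)

lemma trace_mult_mat:
  fixes M :: "'a::comm_semiring_1^'n^'n"
  shows "trace (M ** mat c) = c * trace M"
proof -
  have "(M ** mat c) $ i $ i = c * M $ i $ i" for i
    by (simp add: matrix_matrix_mult_def mat_def if_distrib mult.commute cong: if_cong)
  then show ?thesis by (simp add: trace_def sum_distrib_left)
qed

section \<open>Cyclic segments\<close>

lemma segment_refl:
  assumes "j < length l"
  shows "segment l j j = drop (Suc j) l @ take j l"
proof (cases "Suc j = length l")
  \<comment> \<open>At the last position the rotation is by the full length, hence the
    identity.\<close>
  case True
  then show ?thesis by (simp add: segment_def)
next
  case False
  with assms have "Suc j < length l" by simp
  then show ?thesis by (simp add: segment_def rotate_drop_take)
qed

lemma length_segment_refl: "j < length l \<Longrightarrow> length (segment l j j) = length l - 1"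
  by (simp add: segment_refl)

section \<open>Offsets \<open>k\<close> after position \<open>j\<close> and the corresponding loop
  positions \<open>j'\<close>\<close>

context
  fixes l :: "'g loop" and n j k j' :: nat
  assumes n: "length l = n" and j: "j < n" and k: "k < n - 1" and j': "j' = (Suc j + k) mod n"
begin

text \<open>The bound on \<open>k\<close> excludes \<open>k = n - 1\<close>, the offset at which the
  cycle would return to \<open>j\<close>.\<close>

lemma segment_split_less: "j' < n" "j' \<noteq> j"
proof -
  show "j' < n" using j j' by simp
  show "j' \<noteq> j"
  proof (cases "Suc j + k < n")
    case False
    then have "j' = Suc j + k - n" using j k j' by (simp add: mod_if)
    then show ?thesis using False k by simp
  qed (use j' in simp)
qed

lemma segment_split_index: "(j' + n - Suc j) mod n = k"
proof (cases "Suc j + k < n")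
  case True
  then have "j' + n - Suc j = k + n" using j' by simp
  then show ?thesis using k by simp
next
  case False
  then have "j' = Suc j + k - n" using j k j' by (simp add: mod_if)
  then have "j' + n - Suc j = k" using False by simp
  then show ?thesis using k by simp
qed

text \<open>The \<open>n - 1\<close> positions other than \<open>j\<close> are the \<open>k\<close>
  ones before \<open>j'\<close>, then \<open>j'\<close> itself, then these
  \<open>n - 2 - k\<close>.\<close>

lemma segment_split_index': "(j + n - Suc j') mod n = n - 2 - k"
proof (cases "Suc j + k < n")
  case True
  then have "j + n - Suc j' = n - 2 - k" using j' by simp
  then show ?thesis using k by simp
next
  case False
  then have "j' = Suc j + k - n" using j k j' by (simp add: mod_if)
  then have "j + n - Suc j' = n - 2 - k + n" using False k j by simp
  then have "(j + n - Suc j') mod n = (n - 2 - k) mod n" by (metis mod_add_self2)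
  then show ?thesis using k by simp
qed

lemma segment_refl_rotate: "segment l j j = take (n - 1) (rotate (Suc j) l)"
  using n j by (simp add: segment_def)

lemma nth_segment_split: "segment l j j ! k = l ! j'"
  using n k j' by (simp add: segment_refl_rotate nth_rotate del: rotate_Suc)

lemma take_segment_split: "take k (segment l j j) = segment l j j'"
proof -
  have "segment l j j' = take k (rotate (Suc j) l)"
    unfolding segment_def n segment_split_index ..
  then show ?thesis using k by (simp add: segment_refl_rotate min_def)
qed

text \<open>A further rotation by \<open>Suc k\<close> starts the list just after \<open>j'\<close>,
  and the remainder of the full cycle from \<open>j\<close> is then an initial part of it.\<close>

lemma drop_segment_split: "drop (Suc k) (segment l j j) = segment l j' j"
proof -
  define r where "r = rotate (Suc j) l"
  have "rotate (Suc j') l = rotate (Suc k + Suc j) l"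
    using rotate_conv_mod[of "Suc j'" l] rotate_conv_mod[of "Suc k + Suc j" l] n
    by (simp add: j' mod_Suc_eq add.commute)
  also have "\<dots> = rotate (Suc k) r"
    by (simp only: r_def rotate_rotate)
  also have "\<dots> = drop (Suc k) r @ take (Suc k) r"
    using n k by (simp add: rotate_drop_take r_def)
  finally have "segment l j' j = take (n - 2 - k) (drop (Suc k) r @ take (Suc k) r)"
    unfolding segment_def n segment_split_index' by simp
  \<comment> \<open>The list \<open>drop (Suc k) r\<close> has \<open>n - 1 - k\<close> elements, so
    the wrapped part is not reached.\<close>
  also have "\<dots> = take (n - 2 - k) (drop (Suc k) r)"
    using n by (simp add: r_def)
  also have "\<dots> = drop (Suc k) (take (n - 1) r)"
    using k by (simp add: drop_take)
  finally show ?thesis by (simp add: segment_refl_rotate r_def)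
qed

end

section \<open>Loops and the words they spell\<close>

context group
begin

lemma loops_take: "l \<in> loops G \<Longrightarrow> take k l \<in> loops G"
  and loops_drop: "l \<in> loops G \<Longrightarrow> drop k l \<in> loops G"
  and loops_segment: "l \<in> loops G \<Longrightarrow> segment l i j \<in> loops G"
  by (auto simp: loops_def in_lists_conv_set segment_def
      simp del: rotate_Suc dest!: in_set_takeD in_set_dropD)

lemma loops_fst: "l \<in> loops G \<Longrightarrow> k < length l \<Longrightarrow> fst (l ! k) \<in> carrier G"
  and loops_snd: "l \<in> loops G \<Longrightarrow> k < length l \<Longrightarrow> snd (l ! k) \<in> {1, -1}"
  by (auto simp: loops_def in_lists_conv_set dest!: nth_mem)

lemma word_Nil: "word G [] g = \<one>"
  by (simp add: word_def)

lemma word_Cons: "word G (p # l) g = fst p \<otimes> g [^] snd p \<otimes> word G l g"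
  by (simp add: word_def case_prod_unfold)

lemma word_closed: "l \<in> loops G \<Longrightarrow> g \<in> carrier G \<Longrightarrow> word G l g \<in> carrier G"
  by (induction l) (auto simp: word_Nil word_Cons loops_def)

lemma word_append:
  "l \<in> loops G \<Longrightarrow> m \<in> loops G \<Longrightarrow> g \<in> carrier G \<Longrightarrow> word G (l @ m) g = word G l g \<otimes> word G m g"
proof (induction l)
  case Nil
  then show ?case by (simp add: word_Nil word_closed)
next
  case (Cons p l)
  then have "l \<in> loops G" "fst p \<in> carrier G" by (auto simp: loops_def)
  then show ?case using Cons by (simp add: word_Cons m_assoc word_closed)
qed

end

context compact_lie_group_rep
begin

section \<open>Derivatives of Wilson loops\<close>

text \<open>This is the derivative of \<open>insertion\<close> along the same vector. For sign -1
  the two minus signs cancel.\<close>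

definition double_insertion :: "'g derivation \<Rightarrow> int \<Rightarrow> 'g \<Rightarrow> complex^'n^'n" where
  "double_insertion v \<sigma> g =
     (let R = lie_algebra_rep \<rho> v in if \<sigma> = 1 then \<rho> g ** R ** R else R ** R ** \<rho> (inv g))"

lemma rep_mat_pow: "\<sigma> \<in> {1, -1} \<Longrightarrow> rep_mat (\<lambda>x. \<rho> (x [^] (\<sigma> :: int)))"
  by (elim insertE emptyE;
      rule rep_mat_eq_on[OF rep_mat_rho] rep_mat_eq_on[OF rep_mat_rho_inv];
      simp add: int_pow_neg)

lemma rep_mat_word: "l \<in> loops G \<Longrightarrow> rep_mat (\<lambda>x. \<rho> (word G l x))"
proof (induction l)
  case Nil
  show ?case by (simp add: word_Nil rep_mat_const)
next
  case (Cons p l)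
  then have l: "l \<in> loops G" and p: "fst p \<in> carrier G" "snd p \<in> {1, -1}"
    by (auto simp: loops_def)
  have "rep_mat (\<lambda>x. \<rho> (fst p) ** \<rho> (x [^] snd p) ** \<rho> (word G l x))"
    by (intro rep_mat_mult rep_mat_const rep_mat_pow p Cons.IH l)
  then show ?case
    by (rule rep_mat_eq_on) (use p l in \<open>simp add: word_Cons rho_mult word_closed\<close>)
qed

lemma rep_mat_insertion: "rep_mat (insertion G \<rho> v \<sigma>)"
  unfolding insertion_def[abs_def]
  by (cases "\<sigma> = 1")
    (simp_all add: rep_mat_mult rep_mat_const rep_mat_rho rep_mat_rho_inv rep_mat_uminus)

lemma rep_mat_wilson_path:
  assumes "l \<in> loops G" "j < length l"
  shows "rep_mat (wilson_path G \<rho> l i j)"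
proof -
  have "rep_mat (\<lambda>x. \<rho> (word G (segment l i j) x) ** \<rho> (fst (l ! j)))"
    by (intro rep_mat_mult rep_mat_const rep_mat_word loops_segment assms)
  then show ?thesis
    by (rule rep_mat_eq_on)
      (simp add: wilson_path_def rho_mult word_closed loops_segment loops_fst assms)
qed

lemma rep_fun_wilson: "l \<in> loops G \<Longrightarrow> rep_fun (wilson G \<rho> l)"
  unfolding wilson_def[abs_def] by (intro rep_mat_trace rep_mat_word)

context
  fixes v assumes v: "v \<in> lie_algebra G T A"
begin

lemma mderiv_pow:
  assumes "\<sigma> \<in> {1, -1}" "g \<in> carrier G"
  shows "mderiv v (\<lambda>x. \<rho> (x [^] \<sigma>)) g = insertion G \<rho> v \<sigma> g"
proof -
  consider "\<sigma> = 1" | "\<sigma> = -1" using assms(1) by auto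
  then show ?thesis
  proof cases
    case 1
    have "mderiv v (\<lambda>x. \<rho> (x [^] \<sigma>)) g = mderiv v \<rho> g"
      by (rule mderiv_cong[OF v rep_mat_pow]) (use assms 1 in \<open>simp_all\<close>)
    then show ?thesis using mderiv_rho[OF v assms(2)] 1 by (simp add: insertion_def)
  next
    case 2
    have "mderiv v (\<lambda>x. \<rho> (x [^] \<sigma>)) g = mderiv v (\<lambda>x. \<rho> (inv x)) g"
      by (rule mderiv_cong[OF v rep_mat_pow]) (use assms 2 in \<open>simp_all add: int_pow_neg\<close>)
    then show ?thesis using mderiv_rho_inv[OF v assms(2)] 2 by (simp add: insertion_def)
  qed
qed

lemma mderiv_insertion:
  assumes g: "g \<in> carrier G"
  shows "mderiv v (insertion G \<rho> v \<sigma>) g = double_insertion v \<sigma> g"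
proof (cases "\<sigma> = 1")
  case True
  have "mderiv v (\<lambda>x. \<rho> x ** lie_algebra_rep \<rho> v) g = \<rho> g ** lie_algebra_rep \<rho> v ** lie_algebra_rep \<rho> v"
    using mderiv_mult[OF v rep_mat_rho rep_mat_const g] mderiv_rho[OF v g]
    by (simp add: mderiv_const[OF v])
  then show ?thesis using True by (simp add: insertion_def[abs_def] double_insertion_def Let_def)
next
  case False
  have "mderiv v (\<lambda>x. lie_algebra_rep \<rho> v ** \<rho> (inv x)) g =
      - (lie_algebra_rep \<rho> v ** lie_algebra_rep \<rho> v ** \<rho> (inv g))"
    using mderiv_mult[OF v rep_mat_const rep_mat_rho_inv g] mderiv_rho_inv[OF v g]
    by (simp add: matrix_mul_assoc mderiv_const[OF v] matrix_mult_minus_right)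
  then show ?thesis
    using False mderiv_uminus[OF v rep_mat_mult[OF rep_mat_const rep_mat_rho_inv] g]
    by (simp add: insertion_def[abs_def] double_insertion_def Let_def)
qed

text \<open>By the Leibniz rule each factor \<open>g [^] \<sigma>\<close> is replaced in turn by its
  insertion; the letters of the loop are constant. Induction on the loop differentiates the head
  factor first.\<close>

lemma mderiv_word:
  assumes "l \<in> loops G" "g \<in> carrier G"
  shows "mderiv v (\<lambda>x. \<rho> (word G l x)) g =
    (\<Sum>k<length l. \<rho> (word G (take k l) g \<otimes> fst (l ! k)) ** insertion G \<rho> v (snd (l ! k)) g **
      \<rho> (word G (drop (Suc k) l) g))"
  using assms(1)
proof (induction l)
  case Nil
  show ?case by (simp add: word_Nil mderiv_const[OF v])
next
  case (Cons p l)
  note g = assms(2)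
  have l: "l \<in> loops G" and p: "fst p \<in> carrier G" "snd p \<in> {1, -1}"
    using Cons.prems by (auto simp: loops_def)
  let ?X = "insertion G \<rho> v (snd p) g"
  have "mderiv v (\<lambda>x. \<rho> (word G (p # l) x)) g =
      mderiv v (\<lambda>x. \<rho> (fst p) ** \<rho> (x [^] snd p) ** \<rho> (word G l x)) g"
    by (rule mderiv_cong[OF v rep_mat_word[OF Cons.prems]])
      (use p l g in \<open>simp_all add: word_Cons rho_mult word_closed\<close>)
  also have "\<dots> = \<rho> (fst p) ** \<rho> (g [^] snd p) ** mderiv v (\<lambda>x. \<rho> (word G l x)) g +
      \<rho> (fst p) ** ?X ** \<rho> (word G l g)"
    using mderiv_mult[OF v rep_mat_mult[OF rep_mat_const rep_mat_pow[OF p(2)]] rep_mat_word[OF l] g]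
      mderiv_mult[OF v rep_mat_const rep_mat_pow[OF p(2)] g] mderiv_pow[OF p(2) g]
    by (simp add: mderiv_const[OF v])
  \<comment> \<open>Positions in the tail are shifted by one in \<open>p # l\<close>; the head
    factor supplies the missing term at index 0.\<close>
  also have "\<rho> (fst p) ** \<rho> (g [^] snd p) ** mderiv v (\<lambda>x. \<rho> (word G l x)) g =
      (\<Sum>k<length l. \<rho> (word G (take (Suc k) (p # l)) g \<otimes> fst ((p # l) ! Suc k)) **
        insertion G \<rho> v (snd ((p # l) ! Suc k)) g ** \<rho> (word G (drop (Suc (Suc k)) (p # l)) g))"
    unfolding Cons.IH[OF l] matrix_mult_sum_right
    by (rule sum.cong)
      (use p l g in \<open>auto simp: word_Cons rho_mult word_closed loops_take loops_fst matrix_mul_assoc\<close>)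
  finally show ?case
    using p(1) by (simp add: sum.lessThan_Suc_shift word_Nil add.commute del: sum.lessThan_Suc)
qed

lemma lderiv_wilson:
  assumes l: "l \<in> loops G" and g: "g \<in> carrier G"
  shows "lderiv v (wilson G \<rho> l) g =
    (\<Sum>j<length l. trace (wilson_path G \<rho> l j j g ** insertion G \<rho> v (snd (l ! j)) g))"
proof -
  \<comment> \<open>Cyclicity of the trace moves the part after position \<open>j\<close> to the
    front, where it joins the part before \<open>j\<close> to form the full-cycle path.\<close>
  have "trace (\<rho> (word G (take j l) g \<otimes> fst (l ! j)) ** X ** \<rho> (word G (drop (Suc j) l) g)) =
      trace (wilson_path G \<rho> l j j g ** X)" if j: "j < length l" for j X
  proof -
    let ?c = "fst (l ! j)" and ?u = "word G (take j l) g" and ?w = "word G (drop (Suc j) l) g"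
    have carr: "?c \<in> carrier G" "?u \<in> carrier G" "?w \<in> carrier G"
      using l g j by (auto simp: loops_fst word_closed loops_take loops_drop)
    have "\<rho> (word G (segment l j j) g \<otimes> ?c) = \<rho> ?w ** \<rho> (?u \<otimes> ?c)"
      using carr l g j by (simp add: segment_refl word_append loops_take loops_drop m_assoc rho_mult)
    then show ?thesis
      by (simp add: wilson_path_def trace_mul_sym[of _ "\<rho> ?w"] matrix_mul_assoc)
  qed
  then show ?thesis
    unfolding wilson_def[abs_def]
    by (simp add: lderiv_trace[OF v rep_mat_word] mderiv_word assms trace_sum)
qed

text \<open>The path is the word of the segment times the constant letter of position
  \<open>j\<close>, so \<open>mderiv_word\<close> applies. It remains to convert offsets in the
  segment into positions of the loop, each hit factor cutting the cycle into two paths.\<close>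

lemma mderiv_wilson_path:
  assumes l: "l \<in> loops G" and g: "g \<in> carrier G" and j: "j < length l"
  shows "mderiv v (wilson_path G \<rho> l j j) g =
    (\<Sum>j'\<in>{..<length l} - {j}. wilson_path G \<rho> l j j' g ** insertion G \<rho> v (snd (l ! j')) g **
      wilson_path G \<rho> l j' j g)"
proof -
  define n where "n = length l"
  define s where "s = segment l j j"
  define c where "c = fst (l ! j)"
  have s: "s \<in> loops G" and c: "c \<in> carrier G" and n: "length l = n" and jn: "j < n"
    using l j by (simp_all add: s_def c_def n_def loops_segment loops_fst)
  have "mderiv v (wilson_path G \<rho> l j j) g = mderiv v (\<lambda>x. \<rho> (word G s x) ** \<rho> c) g"
    by (rule mderiv_cong[OF v rep_mat_wilson_path[OF l j]])
      (use s c g in \<open>simp_all add: wilson_path_def s_def[symmetric] c_def[symmetric] rho_mult word_closed\<close>)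
  also have "\<dots> = mderiv v (\<lambda>x. \<rho> (word G s x)) g ** \<rho> c"
    using mderiv_mult[OF v rep_mat_word[OF s] rep_mat_const g] by (simp add: mderiv_const[OF v])
  also have "\<dots> = (\<Sum>k<n - 1. \<rho> (word G (take k s) g \<otimes> fst (s ! k)) **
      insertion G \<rho> v (snd (s ! k)) g ** \<rho> (word G (drop (Suc k) s) g) ** \<rho> c)"
    using length_segment_refl[OF j, folded s_def]
    by (simp add: mderiv_word[OF s g] matrix_mult_sum_left n)
  also have "\<dots> = (\<Sum>j'\<in>{..<n} - {j}. wilson_path G \<rho> l j j' g **
      insertion G \<rho> v (snd (l ! j')) g ** wilson_path G \<rho> l j' j g)"
  proof (rule sum.reindex_bij_witness[where i = "\<lambda>j'. (j' + n - Suc j) mod n"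
        and j = "\<lambda>k. (Suc j + k) mod n"])
    fix k assume "k \<in> {..<n - 1}"
    then have k: "k < n - 1" by simp
    note split = n jn k refl[of "(Suc j + k) mod n"]
    show "((Suc j + k) mod n + n - Suc j) mod n = k"
      by (rule segment_split_index[OF split])
    show "(Suc j + k) mod n \<in> {..<n} - {j}"
      using segment_split_less[OF split] by simp
    show "wilson_path G \<rho> l j ((Suc j + k) mod n) g **
        insertion G \<rho> v (snd (l ! ((Suc j + k) mod n))) g ** wilson_path G \<rho> l ((Suc j + k) mod n) j g =
        \<rho> (word G (take k s) g \<otimes> fst (s ! k)) ** insertion G \<rho> v (snd (s ! k)) g **
        \<rho> (word G (drop (Suc k) s) g) ** \<rho> c"
      unfolding s_def nth_segment_split[OF split] take_segment_split[OF split]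
        drop_segment_split[OF split] wilson_path_def
      using c g by (simp add: c_def[symmetric] rho_mult word_closed loops_segment l matrix_mul_assoc)
  next
    fix j' assume j': "j' \<in> {..<n} - {j}"
    show "(Suc j + (j' + n - Suc j) mod n) mod n = j'"
    proof -
      have "(Suc j + (j' + n - Suc j) mod n) mod n = (Suc j + (j' + n - Suc j)) mod n"
        by (rule mod_add_right_eq)
      also have "\<dots> = j'" using j' jn by simp
      finally show ?thesis .
    qed
    \<comment> \<open>For \<open>j < j'\<close> the offset overshoots by one full cycle; otherwise
      \<open>j' < j\<close> and it is already below \<open>n - 1\<close>.\<close>
    show "(j' + n - Suc j) mod n \<in> {..<n - 1}"
    proof (cases "j < j'")
      case True
      then have "j' + n - Suc j = j' - Suc j + n" by simp
      then have "(j' + n - Suc j) mod n = (j' - Suc j) mod n" by (metis mod_add_self2)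
      then show ?thesis using True j' by simp
    next
      case False
      then have "j' + n - Suc j < n - 1" using j' jn by auto
      then show ?thesis by simp
    qed
  qed
  finally show ?thesis by (simp add: n)
qed

text \<open>A second derivative falls either on the factor already hit, giving the double insertion,
  or on another position, giving a twisting term.\<close>

lemma lderiv_wilson_insertion:
  assumes l: "l \<in> loops G" and g: "g \<in> carrier G" and j: "j < length l"
  shows "lderiv v (\<lambda>x. trace (wilson_path G \<rho> l j j x ** insertion G \<rho> v (snd (l ! j)) x)) g =
    trace (wilson_path G \<rho> l j j g ** double_insertion v (snd (l ! j)) g) +
    (\<Sum>j'\<in>{..<length l} - {j}. trace (wilson_path G \<rho> l j' j g ** insertion G \<rho> v (snd (l ! j)) g **
      wilson_path G \<rho> l j j' g ** insertion G \<rho> v (snd (l ! j')) g))"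
proof -
  \<comment> \<open>Cyclicity exchanges the two halves so that the result has the order used in
    \<open>twisting_at\<close>.\<close>
  have "trace (P ** X ** Q ** Y) = trace (Q ** Y ** P ** X)" for P X Q Y :: "complex^'n^'n"
    using trace_mul_sym[of "P ** X" "Q ** Y"] by (simp add: matrix_mul_assoc)
  then show ?thesis
    using lderiv_trace[OF v rep_mat_mult[OF rep_mat_wilson_path[OF l j] rep_mat_insertion] g]
      mderiv_mult[OF v rep_mat_wilson_path[OF l j] rep_mat_insertion g]
    by (simp add: mderiv_insertion[OF g] mderiv_wilson_path[OF l g j] trace_add
        matrix_mult_sum_left trace_sum)
qed

end

end

section \<open>Integration of the Laplacian\<close>

text \<open>Ordered pairs split into \<open>r < s\<close> and \<open>s < r\<close>, exchanged by
  swapping. This yields the factor 2 in front of the mergers.\<close>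

lemma sum_off_diagonal_symmetric:
  fixes K :: "nat \<Rightarrow> nat \<Rightarrow> 'a::comm_semiring_1"
  assumes "\<And>r s. r \<in> {1..q} \<Longrightarrow> s \<in> {1..q} \<Longrightarrow> K r s = K s r"
  shows "(\<Sum>r=1..q. \<Sum>s\<in>{1..q} - {r}. K r s) =
    2 * (\<Sum>(r, s)\<in>{(r, s). 1 \<le> r \<and> r < s \<and> s \<le> q}. K r s)"
proof -
  let ?L = "{(r, s). 1 \<le> r \<and> r < s \<and> s \<le> q}" and ?U = "{(r, s). 1 \<le> s \<and> s < r \<and> r \<le> q}"
  have fin: "finite ?L" "finite ?U"
    by (auto intro: finite_subset[of _ "{..q} \<times> {..q}"])
  have "(\<Sum>r=1..q. \<Sum>s\<in>{1..q} - {r}. K r s) =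
      (\<Sum>(r, s)\<in>(SIGMA r:{1..q}. {1..q} - {r}). K r s)"
    by (rule sum.Sigma) auto
  also have "(SIGMA r:{1..q}. {1..q} - {r}) = ?L \<union> ?U" by auto
  also have "(\<Sum>(r, s)\<in>?L \<union> ?U. K r s) = (\<Sum>(r, s)\<in>?L. K r s) + (\<Sum>(r, s)\<in>?U. K r s)"
    by (rule sum.union_disjoint) (use fin in auto)
  also have "(\<Sum>(r, s)\<in>?U. K r s) = (\<Sum>(r, s)\<in>?L. K r s)"
    by (rule sum.reindex_bij_witness[where i = prod.swap and j = prod.swap]) (use assms in auto)
  finally show ?thesis by (simp add: mult_2)
qed

context compact_lie_group_rep
begin

text \<open>Recovers the loop from its path at any position, again by cyclicity of the trace; it
  evaluates the Casimir terms.\<close>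

lemma wilson_eq_trace_path:
  assumes l: "l \<in> loops G" and g: "g \<in> carrier G" and j: "j < length l"
  shows "trace (wilson_path G \<rho> l j j g ** \<rho> (g [^] snd (l ! j))) = wilson G \<rho> l g"
proof -
  let ?c = "fst (l ! j)" and ?u = "word G (take j l) g" and ?w = "word G (drop (Suc j) l) g"
    and ?h = "g [^] snd (l ! j)"
  have carr: "?c \<in> carrier G" "?u \<in> carrier G" "?w \<in> carrier G" "?h \<in> carrier G"
    using l g j by (auto simp: loops_fst word_closed loops_take loops_drop)
  have tail: "l ! j # drop (Suc j) l \<in> loops G"
    using loops_drop[OF l, of j] j by (simp add: Cons_nth_drop_Suc)
  have "word G l g = word G (take j l @ l ! j # drop (Suc j) l) g"
    using id_take_nth_drop[OF j] by simp
  also have "\<dots> = ?u \<otimes> (?c \<otimes> ?h \<otimes> ?w)"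
    by (simp add: word_append loops_take l tail g word_Cons)
  finally have "wilson G \<rho> l g = trace (\<rho> ?u ** \<rho> ?c ** \<rho> ?h ** \<rho> ?w)"
    using carr by (simp add: wilson_def rho_mult matrix_mul_assoc)
  also have "\<dots> = trace (\<rho> ?w ** \<rho> ?u ** \<rho> ?c ** \<rho> ?h)"
    by (simp add: trace_mul_sym[of _ "\<rho> ?w"] matrix_mul_assoc)
  also have "\<rho> ?w ** \<rho> ?u ** \<rho> ?c = wilson_path G \<rho> l j j g"
    using carr l g j
    by (simp add: wilson_path_def segment_refl word_append loops_take loops_drop rho_mult matrix_mul_assoc)
  finally show ?thesis ..
qed

context
  fixes d :: nat and \<xi> :: "nat \<Rightarrow> 'g derivation" and lam :: complex
  assumes xi: "\<And>a. a < d \<Longrightarrow> \<xi> a \<in> lie_algebra G T A"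
    and casimir: "rep_casimir \<rho> d \<xi> = mat lam"
begin

text \<open>Summed over the basis, the squares form the Casimir, which acts as the scalar
  \<open>lam\<close>. The contribution has the same form for both signs.\<close>

lemma sum_trace_double_insertion:
  assumes "\<sigma> \<in> {1, -1}" "g \<in> carrier G"
  shows "(\<Sum>a<d. trace (P ** double_insertion (\<xi> a) \<sigma> g)) = lam * trace (P ** \<rho> (g [^] \<sigma>))"
proof -
  let ?R = "\<lambda>a. lie_algebra_rep \<rho> (\<xi> a)"
  have C: "(\<Sum>a<d. trace (Q ** (?R a ** ?R a))) = lam * trace Q" for Q
    using casimir
    by (simp add: trace_sum[symmetric] matrix_mult_sum_right[symmetric] rep_casimir_def trace_mult_mat)
  consider "\<sigma> = 1" | "\<sigma> = -1" using assms(1) by auto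
  then show ?thesis
  proof cases
    case 1
    then show ?thesis
      using C[of "P ** \<rho> g"] assms(2) by (simp add: double_insertion_def Let_def matrix_mul_assoc)
  next
    case 2
    \<comment> \<open>For sign -1 the trailing \<open>\<rho> (inv g)\<close> is moved to the front
      so that the Casimir stands last.\<close>
    have "trace (P ** (R ** R ** N)) = trace (N ** P ** (R ** R))" for R N
      using trace_mul_sym[of N "P ** (R ** R)"] by (simp add: matrix_mul_assoc trace_mul_sym[of _ N])
    then show ?thesis
      using C[of "\<rho> (inv g) ** P"] 2 assms(2) trace_mul_sym[of P "\<rho> (inv g)"]
      by (simp add: double_insertion_def Let_def int_pow_neg)
  qed
qed

text \<open>Each position hit twice contributes \<open>lam\<close> times the loop, and ordered pairs
  of distinct positions assemble into the twisting.\<close>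

lemma sum_lderiv_lderiv_wilson:
  assumes l: "l \<in> loops G" and g: "g \<in> carrier G"
  shows "(\<Sum>a<d. lderiv (\<xi> a) (lderiv (\<xi> a) (wilson G \<rho> l)) g) =
    lam * of_nat (length l) * wilson G \<rho> l g + twisting G \<rho> d \<xi> l g"
proof -
  let ?n = "length l"
  let ?tw = "\<lambda>a j j'. trace (wilson_path G \<rho> l j' j g ** insertion G \<rho> (\<xi> a) (snd (l ! j)) g **
      wilson_path G \<rho> l j j' g ** insertion G \<rho> (\<xi> a) (snd (l ! j')) g)"
  have "lderiv (\<xi> a) (lderiv (\<xi> a) (wilson G \<rho> l)) g =
      (\<Sum>j<?n. trace (wilson_path G \<rho> l j j g ** double_insertion (\<xi> a) (snd (l ! j)) g) +
        (\<Sum>j'\<in>{..<?n} - {j}. ?tw a j j'))" if a: "a < d" for a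
  proof -
    have "lderiv (\<xi> a) (lderiv (\<xi> a) (wilson G \<rho> l)) g = lderiv (\<xi> a) (\<lambda>x. \<Sum>j<?n.
        trace (wilson_path G \<rho> l j j x ** insertion G \<rho> (\<xi> a) (snd (l ! j)) x)) g"
      by (rule lderiv_cong[OF xi[OF a] rep_fun_lderiv[OF xi[OF a] rep_fun_wilson[OF l]] _ g])
        (rule lderiv_wilson[OF xi[OF a] l])
    also have "\<dots> = (\<Sum>j<?n. lderiv (\<xi> a) (\<lambda>x.
        trace (wilson_path G \<rho> l j j x ** insertion G \<rho> (\<xi> a) (snd (l ! j)) x)) g)"
      by (rule lderiv_sum[OF xi[OF a] _ g])
        (simp add: rep_mat_trace rep_mat_mult rep_mat_wilson_path rep_mat_insertion l)
    finally show ?thesis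
      by (simp add: lderiv_wilson_insertion[OF xi[OF a] l g])
  qed
  then have "(\<Sum>a<d. lderiv (\<xi> a) (lderiv (\<xi> a) (wilson G \<rho> l)) g) =
      (\<Sum>a<d. \<Sum>j<?n. trace (wilson_path G \<rho> l j j g ** double_insertion (\<xi> a) (snd (l ! j)) g)) +
      (\<Sum>a<d. \<Sum>j<?n. \<Sum>j'\<in>{..<?n} - {j}. ?tw a j j')"
    by (simp add: sum.distrib)
  also have "(\<Sum>a<d. \<Sum>j<?n. trace (wilson_path G \<rho> l j j g ** double_insertion (\<xi> a) (snd (l ! j)) g)) =
      (\<Sum>j<?n. lam * wilson G \<rho> l g)"
    by (subst sum.swap, rule sum.cong)
      (simp_all add: sum_trace_double_insertion loops_snd[OF l, simplified] g wilson_eq_trace_path[OF l g])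
  also have "(\<Sum>a<d. \<Sum>j<?n. \<Sum>j'\<in>{..<?n} - {j}. ?tw a j j') = twisting G \<rho> d \<xi> l g"
  proof -
    have "(\<Sum>a<d. \<Sum>j<?n. \<Sum>j'\<in>{..<?n} - {j}. ?tw a j j') =
        (\<Sum>j<?n. \<Sum>j'\<in>{..<?n} - {j}. \<Sum>a<d. ?tw a j j')"
      by (subst sum.swap, rule sum.cong[OF refl], rule sum.swap)
    also have "\<dots> = (\<Sum>(j, j')\<in>(SIGMA j:{..<?n}. {..<?n} - {j}). \<Sum>a<d. ?tw a j j')"
      by (rule sum.Sigma) auto
    also have "(SIGMA j:{..<?n}. {..<?n} - {j}) = {(j, j'). j < ?n \<and> j' < ?n \<and> j \<noteq> j'}"
      by auto
    finally show ?thesis by (simp add: twisting_def twisting_at_def)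
  qed
  finally show ?thesis by (simp add: mult_ac)
qed

text \<open>Expanding the product of two first derivatives gives all pairs of insertions, one in
  each loop. In this form the symmetry of the merger is evident.\<close>

lemma merger_eq_sum_lderiv:
  assumes "l \<in> loops G" "l' \<in> loops G" "g \<in> carrier G"
  shows "merger G \<rho> d \<xi> l l' g =
    (\<Sum>a<d. lderiv (\<xi> a) (wilson G \<rho> l) g * lderiv (\<xi> a) (wilson G \<rho> l') g)"
proof -
  have "merger G \<rho> d \<xi> l l' g = (\<Sum>a<d. \<Sum>j<length l. \<Sum>j'<length l'.
      trace (wilson_path G \<rho> l j j g ** insertion G \<rho> (\<xi> a) (snd (l ! j)) g) *
      trace (wilson_path G \<rho> l' j' j' g ** insertion G \<rho> (\<xi> a) (snd (l' ! j')) g))"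
    unfolding merger_def merger_at_def
    by (rule sym, subst sum.swap, rule sum.cong[OF refl], rule sum.swap)
  then show ?thesis
    using assms by (simp add: lderiv_wilson xi sum_product)
qed

text \<open>The Leibniz rule is applied twice: the second derivative hits the same factor again or
  one of those left in \<open>S - {r}\<close>.\<close>

lemma lderiv_lderiv_prod:
  assumes "finite S" "\<And>k. k \<in> S \<Longrightarrow> rep_fun (f k)" and v: "v \<in> lie_algebra G T A" and g: "g \<in> carrier G"
  shows "lderiv v (lderiv v (\<lambda>x. \<Prod>k\<in>S. f k x)) g =
    (\<Sum>r\<in>S. lderiv v (lderiv v (f r)) g * (\<Prod>k\<in>S - {r}. f k g)) +
    (\<Sum>r\<in>S. \<Sum>s\<in>S - {r}. lderiv v (f r) g * lderiv v (f s) g * (\<Prod>k\<in>S - {r, s}. f k g))"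
proof -
  have rep: "rep_fun (\<lambda>x. \<Prod>k\<in>S'. f k x)" if "S' \<subseteq> S" for S'
    by (rule rep_fun_prod) (use that assms(2) in auto)
  have "lderiv v (lderiv v (\<lambda>x. \<Prod>k\<in>S. f k x)) g =
      lderiv v (\<lambda>x. \<Sum>r\<in>S. lderiv v (f r) x * (\<Prod>k\<in>S - {r}. f k x)) g"
    by (rule lderiv_cong[OF v rep_fun_lderiv[OF v rep[OF order_refl]] _ g])
      (rule lderiv_prod[OF v assms(1,2)])
  also have "\<dots> = (\<Sum>r\<in>S. lderiv v (\<lambda>x. lderiv v (f r) x * (\<Prod>k\<in>S - {r}. f k x)) g)"
    by (rule lderiv_sum[OF v _ g]) (intro rep_fun.mult rep_fun_lderiv v assms(2) rep; auto)
  also have "\<dots> = (\<Sum>r\<in>S. lderiv v (lderiv v (f r)) g * (\<Prod>k\<in>S - {r}. f k g) +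
      (\<Sum>s\<in>S - {r}. lderiv v (f r) g * lderiv v (f s) g * (\<Prod>k\<in>S - {r, s}. f k g)))"
  proof (rule sum.cong[OF refl])
    fix r assume r: "r \<in> S"
    have "lderiv v (\<lambda>x. lderiv v (f r) x * (\<Prod>k\<in>S - {r}. f k x)) g =
        lderiv v (f r) g * lderiv v (\<lambda>x. \<Prod>k\<in>S - {r}. f k x) g +
        lderiv v (lderiv v (f r)) g * (\<Prod>k\<in>S - {r}. f k g)"
      by (rule lderiv_mult[OF v rep_fun_lderiv[OF v] rep g]) (use assms(2) r in auto)
    also have "lderiv v (\<lambda>x. \<Prod>k\<in>S - {r}. f k x) g =
        (\<Sum>s\<in>S - {r}. lderiv v (f s) g * (\<Prod>k\<in>S - {r} - {s}. f k g))"
      by (rule lderiv_prod[OF v _ _ g]) (use assms(1,2) in auto)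
    also have "lderiv v (f r) g * \<dots> =
        (\<Sum>s\<in>S - {r}. lderiv v (f r) g * lderiv v (f s) g * (\<Prod>k\<in>S - {r, s}. f k g))"
    proof -
      have "S - {r} - {s} = S - {r, s}" for s by auto
      then show ?thesis by (simp only: sum_distrib_left mult.assoc)
    qed
    finally show "lderiv v (\<lambda>x. lderiv v (f r) x * (\<Prod>k\<in>S - {r}. f k x)) g =
        lderiv v (lderiv v (f r)) g * (\<Prod>k\<in>S - {r}. f k g) +
        (\<Sum>s\<in>S - {r}. lderiv v (f r) g * lderiv v (f s) g * (\<Prod>k\<in>S - {r, s}. f k g))"
      by (simp only: add.commute)
  qed
  finally show ?thesis by (simp add: sum.distrib)
qed

lemma integral_wilson_loops:
  fixes l :: "nat \<Rightarrow> 'g loop"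
  assumes l: "\<And>r. r \<in> {1..q} \<Longrightarrow> l r \<in> loops G"
  shows "lam * of_nat (\<Sum>r=1..q. length (l r)) * (\<integral>g. (\<Prod>k=1..q. wilson G \<rho> (l k) g) \<partial>\<mu>)
         = - 2 * (\<Sum>(r, s)\<in>{(r, s). 1 \<le> r \<and> r < s \<and> s \<le> q}.
               (\<integral>g. merger G \<rho> d \<xi> (l r) (l s) g *
                    (\<Prod>k\<in>{1..q} - {r, s}. wilson G \<rho> (l k) g) \<partial>\<mu>))
           - (\<Sum>r=1..q.
               (\<integral>g. twisting G \<rho> d \<xi> (l r) g *
                    (\<Prod>k\<in>{1..q} - {r}. wilson G \<rho> (l k) g) \<partial>\<mu>))"
proof -
  define S where "S = {1..q}"
  define W where "W k = wilson G \<rho> (l k)" for k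
  define N :: complex where "N = of_nat (\<Sum>r\<in>S. length (l r))"
  define M where "M r s g = merger G \<rho> d \<xi> (l r) (l s) g * (\<Prod>k\<in>S - {r, s}. W k g)" for r s g
  define Tw where "Tw r g = twisting G \<rho> d \<xi> (l r) g * (\<Prod>k\<in>S - {r}. W k g)" for r g
  have l: "l r \<in> loops G" if "r \<in> S" for r using l that by (simp add: S_def)
  have rep_W: "rep_fun (W k)" if "k \<in> S" for k
    using rep_fun_wilson[OF l[OF that]] by (simp add: W_def[abs_def])
  have rep_prod: "rep_fun (\<lambda>g. \<Prod>k\<in>S'. W k g)" if "S' \<subseteq> S" for S'
    by (rule rep_fun_prod) (use that rep_W in auto)
  note rep_F = rep_prod[OF order_refl]
  have rep_lderiv: "rep_fun (lderiv (\<xi> a) f)" if "a < d" "rep_fun f" for a f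
    by (rule rep_fun_lderiv[OF xi[OF that(1)] that(2)])
  have merger: "merger G \<rho> d \<xi> (l r) (l s) g = (\<Sum>a<d. lderiv (\<xi> a) (W r) g * lderiv (\<xi> a) (W s) g)"
    if "r \<in> S" "s \<in> S" "g \<in> carrier G" for r s g
    unfolding W_def using that l by (intro merger_eq_sum_lderiv) auto
  have twisting: "(\<Sum>a<d. lderiv (\<xi> a) (lderiv (\<xi> a) (W r)) g) =
      lam * of_nat (length (l r)) * W r g + twisting G \<rho> d \<xi> (l r) g"
    if "r \<in> S" "g \<in> carrier G" for r g
    unfolding W_def using that l by (intro sum_lderiv_lderiv_wilson) auto
  have rep_M: "rep_fun (M r s)" if rs: "r \<in> S" "s \<in> S" for r s
  proof (rule rep_fun.eq_on)
    show "rep_fun (\<lambda>g. (\<Sum>a<d. lderiv (\<xi> a) (W r) g * lderiv (\<xi> a) (W s) g) * (\<Prod>k\<in>S - {r, s}. W k g))"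
      by (intro rep_fun.mult rep_fun_sum rep_prod rep_lderiv rep_W rs) auto
  qed (simp add: M_def merger rs)
  \<comment> \<open>The twisting is the Laplacian of the loop minus its Casimir part, and both of
    these are visibly representative functions.\<close>
  have rep_Tw: "rep_fun (Tw r)" if r: "r \<in> S" for r
  proof (rule rep_fun.eq_on)
    show "rep_fun (\<lambda>g. ((\<Sum>a<d. lderiv (\<xi> a) (lderiv (\<xi> a) (W r)) g) +
        (- (lam * of_nat (length (l r)))) * W r g) * (\<Prod>k\<in>S - {r}. W k g))"
      by (intro rep_fun.mult rep_fun.add rep_fun.const rep_fun_sum rep_prod rep_lderiv rep_W r) auto
  qed (simp add: Tw_def twisting r)
  have M_sym: "M r s g = M s r g" if "r \<in> S" "s \<in> S" "g \<in> carrier G" for r s g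
    using that by (simp add: M_def merger insert_commute mult.commute)
  have laplacian: "(\<Sum>a<d. lderiv (\<xi> a) (lderiv (\<xi> a) (\<lambda>x. \<Prod>k\<in>S. W k x)) g) =
      lam * N * (\<Prod>k\<in>S. W k g) + (\<Sum>r\<in>S. Tw r g) + (\<Sum>r\<in>S. \<Sum>s\<in>S - {r}. M r s g)"
    if g: "g \<in> carrier G" for g
  proof -
    have "(\<Sum>a<d. lderiv (\<xi> a) (lderiv (\<xi> a) (\<lambda>x. \<Prod>k\<in>S. W k x)) g) =
        (\<Sum>a<d. \<Sum>r\<in>S. lderiv (\<xi> a) (lderiv (\<xi> a) (W r)) g * (\<Prod>k\<in>S - {r}. W k g)) +
        (\<Sum>a<d. \<Sum>r\<in>S. \<Sum>s\<in>S - {r}.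
          lderiv (\<xi> a) (W r) g * lderiv (\<xi> a) (W s) g * (\<Prod>k\<in>S - {r, s}. W k g))"
      by (subst sum.distrib[symmetric], rule sum.cong[OF refl], rule lderiv_lderiv_prod) (use xi g rep_W in \<open>auto simp: S_def\<close>)
    also have "(\<Sum>a<d. \<Sum>r\<in>S. lderiv (\<xi> a) (lderiv (\<xi> a) (W r)) g * (\<Prod>k\<in>S - {r}. W k g)) =
        (\<Sum>r\<in>S. (\<Sum>a<d. lderiv (\<xi> a) (lderiv (\<xi> a) (W r)) g) * (\<Prod>k\<in>S - {r}. W k g))"
      unfolding sum_distrib_right by (rule sum.swap)
    also have "\<dots> = (\<Sum>r\<in>S. lam * of_nat (length (l r)) * (\<Prod>k\<in>S. W k g) + Tw r g)"
    proof (rule sum.cong[OF refl])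
      fix r assume r: "r \<in> S"
      have "(\<Prod>k\<in>S. W k g) = W r g * (\<Prod>k\<in>S - {r}. W k g)"
        by (rule prod.remove[OF _ r]) (simp add: S_def)
      then show "(\<Sum>a<d. lderiv (\<xi> a) (lderiv (\<xi> a) (W r)) g) * (\<Prod>k\<in>S - {r}. W k g) =
          lam * of_nat (length (l r)) * (\<Prod>k\<in>S. W k g) + Tw r g"
        using r g by (simp add: twisting Tw_def distrib_right mult.assoc)
    qed
    also have "\<dots> = lam * N * (\<Prod>k\<in>S. W k g) + (\<Sum>r\<in>S. Tw r g)"
      by (simp add: sum.distrib N_def sum_distrib_left sum_distrib_right)
    also have "(\<Sum>a<d. \<Sum>r\<in>S. \<Sum>s\<in>S - {r}.
        lderiv (\<xi> a) (W r) g * lderiv (\<xi> a) (W s) g * (\<Prod>k\<in>S - {r, s}. W k g)) =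
        (\<Sum>r\<in>S. \<Sum>s\<in>S - {r}. M r s g)"
      by (subst sum.swap, rule sum.cong[OF refl], subst sum.swap, rule sum.cong[OF refl])
        (use g in \<open>simp add: M_def merger sum_distrib_right\<close>)
    finally show ?thesis .
  qed
  have int_Tw: "integrable \<mu> (Tw r)" if "r \<in> S" for r
    by (intro rep_fun_integrable rep_Tw that)
  have int_M: "integrable \<mu> (M r s)" if "r \<in> S" "s \<in> S" for r s
    by (intro rep_fun_integrable rep_M that)
  \<comment> \<open>Each summand is the derivative of a representative function, hence has integral
    zero.\<close>
  have "0 = (\<Sum>a<d. \<integral>g. lderiv (\<xi> a) (lderiv (\<xi> a) (\<lambda>x. \<Prod>k\<in>S. W k x)) g \<partial>\<mu>)"
    using integral_lderiv[OF xi rep_lderiv[OF _ rep_F]] by simp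
  also have "\<dots> = (\<integral>g. (\<Sum>a<d. lderiv (\<xi> a) (lderiv (\<xi> a) (\<lambda>x. \<Prod>k\<in>S. W k x)) g) \<partial>\<mu>)"
    by (rule Bochner_Integration.integral_sum[symmetric])
      (simp add: rep_fun_integrable rep_lderiv rep_F)
  also have "\<dots> = (\<integral>g. lam * N * (\<Prod>k\<in>S. W k g) + (\<Sum>r\<in>S. Tw r g) +
      (\<Sum>r\<in>S. \<Sum>s\<in>S - {r}. M r s g) \<partial>\<mu>)"
    by (rule Bochner_Integration.integral_cong) (auto simp: space_mu laplacian)
  also have "\<dots> = lam * N * (\<integral>g. (\<Prod>k\<in>S. W k g) \<partial>\<mu>) + (\<Sum>r\<in>S. \<integral>g. Tw r g \<partial>\<mu>) +
      (\<Sum>r\<in>S. \<Sum>s\<in>S - {r}. \<integral>g. M r s g \<partial>\<mu>)"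
  proof -
    have F: "integrable \<mu> (\<lambda>g. lam * N * (\<Prod>k\<in>S. W k g))"
      by (intro integrable_mult_right rep_fun_integrable rep_F)
    have Tw: "integrable \<mu> (\<lambda>g. \<Sum>r\<in>S. Tw r g)"
      by (intro Bochner_Integration.integrable_sum int_Tw)
    have M: "integrable \<mu> (\<lambda>g. \<Sum>s\<in>S - {r}. M r s g)" if "r \<in> S" for r
      by (intro Bochner_Integration.integrable_sum int_M) (use that in auto)
    have MM: "integrable \<mu> (\<lambda>g. \<Sum>r\<in>S. \<Sum>s\<in>S - {r}. M r s g)"
      by (intro Bochner_Integration.integrable_sum M)
    have "(\<integral>g. (\<Sum>r\<in>S. \<Sum>s\<in>S - {r}. M r s g) \<partial>\<mu>) =
        (\<Sum>r\<in>S. \<integral>g. (\<Sum>s\<in>S - {r}. M r s g) \<partial>\<mu>)"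
      by (rule Bochner_Integration.integral_sum[OF M])
    also have "\<dots> = (\<Sum>r\<in>S. \<Sum>s\<in>S - {r}. \<integral>g. M r s g \<partial>\<mu>)"
      by (intro sum.cong refl Bochner_Integration.integral_sum int_M) auto
    finally have "(\<integral>g. (\<Sum>r\<in>S. \<Sum>s\<in>S - {r}. M r s g) \<partial>\<mu>) =
        (\<Sum>r\<in>S. \<Sum>s\<in>S - {r}. \<integral>g. M r s g \<partial>\<mu>)" .
    moreover have "(\<integral>g. (\<Sum>r\<in>S. Tw r g) \<partial>\<mu>) = (\<Sum>r\<in>S. \<integral>g. Tw r g \<partial>\<mu>)"
      by (rule Bochner_Integration.integral_sum[OF int_Tw])
    ultimately show ?thesis
      by (simp add: Bochner_Integration.integral_add[OF Bochner_Integration.integrable_add[OF F Tw] MM]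
          Bochner_Integration.integral_add[OF F Tw])
  qed
  \<comment> \<open>By symmetry of the merger integrand, each unordered pair of loops is counted
    twice.\<close>
  also have "(\<Sum>r\<in>S. \<Sum>s\<in>S - {r}. \<integral>g. M r s g \<partial>\<mu>) =
      2 * (\<Sum>(r, s)\<in>{(r, s). 1 \<le> r \<and> r < s \<and> s \<le> q}. \<integral>g. M r s g \<partial>\<mu>)"
    unfolding S_def
  proof (rule sum_off_diagonal_symmetric)
    show "(\<integral>g. M r s g \<partial>\<mu>) = (\<integral>g. M s r g \<partial>\<mu>)" if "r \<in> {1..q}" "s \<in> {1..q}" for r s
      by (rule Bochner_Integration.integral_cong)
        (use that in \<open>auto simp: space_mu S_def intro: M_sym\<close>)
  qed
  finally have "lam * N * (\<integral>g. (\<Prod>k\<in>S. W k g) \<partial>\<mu>) =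
      - 2 * (\<Sum>(r, s)\<in>{(r, s). 1 \<le> r \<and> r < s \<and> s \<le> q}. \<integral>g. M r s g \<partial>\<mu>) -
      (\<Sum>r\<in>S. \<integral>g. Tw r g \<partial>\<mu>)"
    by algebra
  then show ?thesis unfolding M_def Tw_def N_def W_def S_def .
qed

end

end

theorem corollary3p7:
  fixes G :: "('g, 'm) monoid_scheme"
    and T :: "'g topology"
    and A :: "('g, 'e::real_normed_vector) chart set"
    and \<mu> :: "'g measure"
    and \<kappa> :: "'g derivation \<Rightarrow> 'g derivation \<Rightarrow> real"
    and d :: nat
    and \<xi> :: "nat \<Rightarrow> 'g derivation"
    and \<rho> :: "'g \<Rightarrow> complex^'n^'n"
    and lam :: complex
    and q :: nat
    and l :: "nat \<Rightarrow> 'g loop"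
  assumes "lie_group G T A"
    and "compact_space T"
    and "normalized_haar_measure G T \<mu>"
    and "Ad_invariant_inner_product G T A \<kappa>"
    and "orthonormal_basis G T A \<kappa> d \<xi>"
    and "lie_group_rep G A \<rho>"
    and "irreducible_rep G \<rho>"
    and "rep_casimir \<rho> d \<xi> = mat lam"
    and "\<And>r. r \<in> {1..q} \<Longrightarrow> l r \<in> loops G"
  shows "lam * of_nat (\<Sum>r=1..q. length (l r)) *
           (\<integral>g. (\<Prod>k=1..q. wilson G \<rho> (l k) g) \<partial>\<mu>)
         = - 2 * (\<Sum>(r, s)\<in>{(r, s). 1 \<le> r \<and> r < s \<and> s \<le> q}.
               (\<integral>g. merger G \<rho> d \<xi> (l r) (l s) g *
                    (\<Prod>k\<in>{1..q} - {r, s}. wilson G \<rho> (l k) g) \<partial>\<mu>))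
           - (\<Sum>r=1..q.
               (\<integral>g. twisting G \<rho> d \<xi> (l r) g *
                    (\<Prod>k\<in>{1..q} - {r}. wilson G \<rho> (l k) g) \<partial>\<mu>))"
proof -
  interpret compact_lie_group_rep G T A \<rho> \<mu>
    by (intro compact_lie_group_rep.intro compact_lie_group_rep_axioms.intro assms(1-3,6))
  show ?thesis
    by (rule integral_wilson_loops) (use assms(5,8,9) in \<open>auto simp: orthonormal_basis_def\<close>)
qed

end
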